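(* Let $p$ be a prime and $s$ a positive integer. Let $f,g\in\mathbb{Z}[x]$ be monic polynomials with nonzero resultant $r$ such that $\min\{v_p(f(n)),v_p(g(n))\}\ge s$ for every integer $n$, and put $S=\max_{n\in\mathbb{Z}}\min\{v_p(f(n)),v_p(g(n))\}$. Then $$v_p(r)\ \ge\ S-s+p\,s^2\,\frac{p-1}{p-p^{\,1-\lfloor \log_p((p-1)s+1)\rfloor}}.$$
   Context: $v_p$ denotes the $p$-adic valuation; the resultant of monic $f=\prod_i(x-\alpha_i)$, $g=\prod_j(x-\beta_j)$ is $r=\prod_{i,j}(\alpha_i-\beta_j)$. *)

theory Defs
  imports "Subresultants.Resultant_Prelim" "HOL-Computational_Algebra.Primes" "HOL-Library.Extended_Nat"
begin

definition vp :: "nat \<Rightarrow> int \<Rightarrow> enat" where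
  "vp p x = (if x = 0 then \<infinity> else enat (multiplicity (int p) x))"

end

theory Submission
  imports Defs "Subresultants.Subresultant" "HOL-Computational_Algebra.Fundamental_Theorem_Algebra"
begin

text \<open>Extend the \<open>p\<close>-adic valuation \<open>v\<close> to the roots of \<open>f\<close> and \<open>g\<close>, so that \<open>v(r)\<close> is the sum of
  \<open>v(f(\<beta>))\<close> over the roots \<open>\<beta>\<close> of \<open>g\<close>. Put \<open>L = \<lfloor>log\<^sub>p ((p - 1) s + 1)\<rfloor>\<close> and let \<open>\<theta>\<close> be the sum of
  \<open>p\<^bsup>-t\<^esup>\<close> for \<open>t = 1, \<dots>, L\<close>; the bound to be shown is \<open>S - s + s\<^sup>2 / \<theta>\<close>. This is an equilibrium
  problem on the tree of \<open>p\<close>-adic discs of radius at least \<open>p\<^bsup>-L\<^esup>\<close>: let \<open>W(x)\<close> be \<open>s / \<theta>\<close> times the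
  average of \<open>min L (v(x - c))\<close> over the residues \<open>c\<close> modulo \<open>p ^ L\<close>, the potential of the uniform
  distribution, so that \<open>W \<le> s\<close> everywhere. The Newton expansion of \<open>f\<close> in falling factorials
  gives \<open>v(f(x)) \<ge> W(x)\<close> for all integral \<open>x\<close>. The same estimate for \<open>g\<close> at a generic point of the disc
  of radius \<open>p\<^bsup>-L\<^esup>\<close> around \<open>c\<close> shows that \<open>min L (v(\<beta> - c))\<close> sums over \<open>\<beta>\<close> to at least \<open>s\<close>, whence
  the sum of \<open>W(\<beta>)\<close> is at least \<open>s\<^sup>2 / \<theta>\<close>. Finally, if the root closest to an integer \<open>n\<close> at which
  \<open>S\<close> is attained is a root \<open>\<beta>\<close> of \<open>g\<close> (the other case is symmetric), then
  \<open>v(f(\<beta>)) \<ge> v(f(n)) \<ge> S\<close>, which exceeds \<open>W(\<beta>)\<close> by at least \<open>S - s\<close>.\<close>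

subsection \<open>Maximal subrings avoiding an element\<close>

definition subring :: "'a::field set \<Rightarrow> bool" where
  "subring R \<longleftrightarrow> 1 \<in> R \<and> (\<forall>x\<in>R. \<forall>y\<in>R. x + y \<in> R \<and> x * y \<in> R) \<and> (\<forall>x\<in>R. - x \<in> R)"

lemma subringD:
  assumes "subring R"
  shows subring_1: "1 \<in> R"
    and subring_add: "\<And>x y. x \<in> R \<Longrightarrow> y \<in> R \<Longrightarrow> x + y \<in> R"
    and subring_mult: "\<And>x y. x \<in> R \<Longrightarrow> y \<in> R \<Longrightarrow> x * y \<in> R"
    and subring_uminus: "\<And>x. x \<in> R \<Longrightarrow> - x \<in> R"
  using assms by (auto simp: subring_def)

lemma subring_0: "subring R \<Longrightarrow> 0 \<in> R"
  using subring_add[OF _ subring_1 subring_uminus[OF _ subring_1], of R] by simp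

lemma subring_diff: "subring R \<Longrightarrow> x \<in> R \<Longrightarrow> y \<in> R \<Longrightarrow> x - y \<in> R"
  using subring_add[of R x "- y"] subring_uminus[of R y] by simp

lemma subring_power: "subring R \<Longrightarrow> x \<in> R \<Longrightarrow> x ^ n \<in> R"
  by (induction n) (auto intro: subring_1 subring_mult)

lemma subring_sum: "subring R \<Longrightarrow> (\<And>i. i \<in> I \<Longrightarrow> f i \<in> R) \<Longrightarrow> sum f I \<in> R"
  by (induction I rule: infinite_finite_induct) (auto intro: subring_0 subring_add)

lemma subring_of_int:
  assumes "subring R" shows "of_int z \<in> R"
proof -
  have "of_nat n \<in> R" for n
    by (induction n) (auto intro: subring_0 subring_1 subring_add assms)
  then show ?thesis
    by (cases z rule: int_cases2) (auto intro: subring_uminus[OF assms])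
qed

lemma subring_Ints: "subring \<int>"
  by (auto simp: subring_def)

lemma subring_Union_chain:
  assumes "\<C> \<noteq> {}" and "subset.chain A \<C>" and sub: "\<And>R. R \<in> \<C> \<Longrightarrow> subring R"
  shows "subring (\<Union>\<C>)"
proof -
  have "\<exists>T\<in>\<C>. x \<in> T \<and> y \<in> T" if "x \<in> \<Union>\<C>" "y \<in> \<Union>\<C>" for x y
  proof -
    obtain A B where AB: "A \<in> \<C>" "B \<in> \<C>" "x \<in> A" "y \<in> B"
      using \<open>x \<in> \<Union>\<C>\<close> \<open>y \<in> \<Union>\<C>\<close> by blast
    then have "A \<subseteq> B \<or> B \<subseteq> A" using assms(2) unfolding subset.chain_def by blast
    with AB show ?thesis by blast
  qed
  then have "x + y \<in> \<Union>\<C>" "x * y \<in> \<Union>\<C>" if "x \<in> \<Union>\<C>" "y \<in> \<Union>\<C>" for x y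
    using that subring_add[OF sub] subring_mult[OF sub] by blast+
  moreover have "1 \<in> \<Union>\<C>"
    using assms(1) subring_1[OF sub] by blast
  moreover have "- x \<in> \<Union>\<C>" if "x \<in> \<Union>\<C>" for x
    using that subring_uminus[OF sub] by blast
  ultimately show ?thesis unfolding subring_def by blast
qed

text \<open>Zorn's lemma. It is used with \<open>\<int>\<close> and \<open>u = 1 / p\<close>, so
  that \<open>p\<close> stays a non-unit in \<open>R\<close>.\<close>

lemma ex_maximal_subring_avoiding:
  assumes "subring R0" and "u \<notin> R0"
  obtains R where "subring R" and "R0 \<subseteq> R" and "u \<notin> R"
    and "\<And>T. subring T \<Longrightarrow> R \<subseteq> T \<Longrightarrow> u \<notin> T \<Longrightarrow> T = R"
proof -
  define \<A> where "\<A> = {T. subring T \<and> R0 \<subseteq> T \<and> u \<notin> T}"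
  have "\<Union>\<C> \<in> \<A>" if "\<C> \<noteq> {}" "subset.chain \<A> \<C>" for \<C>
  proof -
    have "\<C> \<subseteq> \<A>" using that(2) by (auto simp: subset.chain_def)
    moreover have "subring (\<Union>\<C>)"
      using that \<open>\<C> \<subseteq> \<A>\<close> by (intro subring_Union_chain) (auto simp: \<A>_def)
    ultimately show ?thesis using that(1) unfolding \<A>_def by blast
  qed
  moreover have "\<A> \<noteq> {}" using assms by (auto simp: \<A>_def)
  ultimately obtain R where "R \<in> \<A>" and "\<forall>X\<in>\<A>. R \<subseteq> X \<longrightarrow> X = R"
    using subset_Zorn_nonempty[of \<A>] by blast
  then show thesis by (intro that[of R]) (auto simp: \<A>_def)
qed

definition adjoin :: "'a::field set \<Rightarrow> 'a \<Rightarrow> 'a set" where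
  "adjoin R x = {poly h x | h. \<forall>i. coeff h i \<in> R}"

lemma adjoinI: "(\<And>i. coeff h i \<in> R) \<Longrightarrow> poly h x \<in> adjoin R x"
  unfolding adjoin_def by blast

lemma subring_adjoin:
  assumes "subring R" shows "subring (adjoin R x)"
proof -
  have "poly h x + poly k x \<in> adjoin R x" "poly h x * poly k x \<in> adjoin R x" "- poly h x \<in> adjoin R x"
    if "\<forall>i. coeff h i \<in> R" "\<forall>i. coeff k i \<in> R" for h k
  proof -
    have "\<forall>i. coeff (h + k) i \<in> R" "\<forall>i. coeff (h * k) i \<in> R" "\<forall>i. coeff (- h) i \<in> R"
      using that assms
      by (auto simp: coeff_mult intro: subring_add subring_uminus subring_mult subring_sum)
    then show "poly h x + poly k x \<in> adjoin R x" "poly h x * poly k x \<in> adjoin R x" "- poly h x \<in> adjoin R x"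
      using adjoinI[of "h + k" R x] adjoinI[of "h * k" R x] adjoinI[of "- h" R x] by simp_all
  qed
  moreover have "1 \<in> adjoin R x"
    using adjoinI[of 1 R x] subring_0[OF assms] subring_1[OF assms] by (simp add: coeff_1)
  ultimately show ?thesis
    unfolding subring_def adjoin_def by blast
qed

lemma adjoin_superset: "subring R \<Longrightarrow> R \<subseteq> adjoin R x"
  unfolding adjoin_def
  by (auto intro!: exI[of _ "[:_:]"] subring_0 simp: coeff_pCons split: nat.split)

lemma adjoin_self: "subring R \<Longrightarrow> x \<in> adjoin R x"
  unfolding adjoin_def
  by (auto intro!: exI[of _ "[:0, 1:]"] subring_0 subring_1 simp: coeff_pCons split: nat.split)

locale maximal_avoiding_subring =
  fixes R :: "'a::field set" and q :: 'a
  assumes subring: "subring R" and q: "q \<in> R" "q \<noteq> 0" and inv_q: "1 / q \<notin> R"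
    and maximal: "\<And>T. subring T \<Longrightarrow> R \<subseteq> T \<Longrightarrow> 1 / q \<notin> T \<Longrightarrow> T = R"
begin

text \<open>Adjoining \<open>x\<close> enlarges \<open>R\<close> properly, so by maximality the
  larger ring contains \<open>1 / q\<close>.\<close>

lemma inv_q_expansion:
  assumes "x \<notin> R"
  shows "\<exists>(a :: nat \<Rightarrow> 'a) n. (\<forall>i. a i \<in> R) \<and> q * (\<Sum>i\<le>n. a i * x ^ i) = 1"
proof -
  have "1 / q \<in> adjoin R x"
    using maximal[OF subring_adjoin[OF subring] adjoin_superset[OF subring], of x]
      adjoin_self[OF subring, of x] assms by blast
  then obtain h where "\<forall>i. coeff h i \<in> R" "1 / q = poly h x"
    by (auto simp: adjoin_def)
  then show ?thesis using q
    by (intro exI[of _ "coeff h"] exI[of _ "degree h"]) (auto simp: poly_altdef field_simps)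
qed

text \<open>If the inverse \<open>e\<close> were missing from \<open>R\<close>, then
  \<open>1 / q\<close> would be a polynomial in \<open>e\<close>. Multiplying by a power of
  \<open>1 - q * b\<close>, which is \<open>1\<close> modulo \<open>q\<close>, clears the
  denominators and puts \<open>1 / q\<close> into \<open>R\<close>.\<close>

lemma one_minus_unit:
  assumes b: "b \<in> R"
  shows "1 - q * b \<noteq> 0" and "1 / (1 - q * b) \<in> R"
proof -
  show nz: "1 - q * b \<noteq> 0"
  proof
    assume "1 - q * b = 0"
    then have "b = 1 / q" using q by (simp add: field_simps)
    with b inv_q show False by simp
  qed
  define e where "e = 1 / (1 - q * b)"
  have pow: "\<exists>t\<in>R. (1 - q * b) ^ d = 1 - q * t" for d
  proof (induction d)
    case 0 then show ?case by (auto intro!: bexI[of _ 0] subring_0 subring)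
  next
    case (Suc d)
    then obtain t where t: "t \<in> R" "(1 - q * b) ^ d = 1 - q * t" by blast
    have "(1 - q * b) ^ Suc d = 1 - q * (t + b - q * b * t)"
      unfolding power_Suc t(2) by (simp add: algebra_simps)
    moreover have "t + b - q * b * t \<in> R"
      using t b q subring by (intro subring_diff subring_add subring_mult) auto
    ultimately show ?case by blast
  qed
  have "e \<in> R"
  proof (rule ccontr)
    assume "e \<notin> R"
    then obtain a :: "nat \<Rightarrow> 'a" and d where a: "\<forall>i. a i \<in> R" "q * (\<Sum>i\<le>d. a i * e ^ i) = 1"
      using inv_q_expansion by blast
    obtain t where t: "t \<in> R" "(1 - q * b) ^ d = 1 - q * t" using pow by blast
    define r where "r = (\<Sum>i\<le>d. a i * (1 - q * b) ^ (d - i))"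
    have "r \<in> R" unfolding r_def using a b q subring
      by (intro subring_sum subring_mult subring_power subring_diff subring_1) auto
    have "(1 - q * b) ^ d = (1 - q * b) ^ d * (q * (\<Sum>i\<le>d. a i * e ^ i))" using a by simp
    also have "\<dots> = q * (\<Sum>i\<le>d. a i * ((1 - q * b) ^ d * e ^ i))"
      by (simp add: sum_distrib_left algebra_simps)
    also have "(\<Sum>i\<le>d. a i * ((1 - q * b) ^ d * e ^ i)) = r"
      unfolding r_def using nz by (intro sum.cong) (auto simp: e_def power_diff power_one_over)
    finally have "1 = q * (r + t)" using t by (simp add: algebra_simps)
    then have "1 / q = r + t" using q by (simp add: field_simps)
    then show False using inv_q subring_add[OF subring \<open>r \<in> R\<close> t(1)] by simp
  qed
  then show "1 / (1 - q * b) \<in> R" by (simp add: e_def)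
qed

text \<open>Dividing by the unit \<open>1 - q * b 0\<close>, the second expansion expresses \<open>x ^ m\<close> through lower
  powers of \<open>x\<close>, which eliminates the top term of the first.\<close>

lemma shorten_expansion:
  fixes a b :: "nat \<Rightarrow> 'a"
  assumes "x \<noteq> 0" and a: "\<forall>i. a i \<in> R" "q * (\<Sum>i\<le>m. a i * x ^ i) = 1"
    and b: "\<forall>i. b i \<in> R" "q * (\<Sum>i\<le>n. b i * (1 / x) ^ i) = 1" and "n \<le> m" "0 < m"
  shows "\<exists>a'. (\<forall>i. a' i \<in> R) \<and> q * (\<Sum>i\<le>m - 1. a' i * x ^ i) = 1"
proof -
  define e where "e = 1 / (1 - q * b 0)"
  have e: "e \<in> R" "1 - q * b 0 \<noteq> 0" using one_minus_unit b by (auto simp: e_def)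
  define k where "k j = (if j \<le> n then e * b j else 0)" for j
  have k: "k j \<in> R" for j
    using e b subring by (auto simp: k_def intro: subring_mult subring_0)
  have "1 = q * (\<Sum>i\<le>n. b i * (1 / x) ^ i)" using b by simp
  also have "(\<Sum>i\<le>n. b i * (1 / x) ^ i) = (\<Sum>i\<le>m. (if i \<le> n then b i else 0) * (1 / x) ^ i)"
    using \<open>n \<le> m\<close> by (intro sum.mono_neutral_cong_left) auto
  also have "\<dots> = b 0 + (\<Sum>i=1..m. (if i \<le> n then b i else 0) * (1 / x) ^ i)"
    by (simp add: atMost_atLeast0 sum.atLeast_Suc_atMost)
  finally have "1 - q * b 0 = q * (\<Sum>i=1..m. (if i \<le> n then b i else 0) * (1 / x) ^ i)"
    by (simp add: algebra_simps)
  then have "1 = e * (q * (\<Sum>i=1..m. (if i \<le> n then b i else 0) * (1 / x) ^ i))"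
    using e unfolding e_def by (metis divide_self_if times_divide_eq_left mult_1)
  also have "\<dots> = q * (\<Sum>i=1..m. k i * (1 / x) ^ i)"
    unfolding sum_distrib_left by (intro sum.cong) (auto simp: k_def)
  finally have "x ^ m = x ^ m * (q * (\<Sum>i=1..m. k i * (1 / x) ^ i))" by simp
  also have "\<dots> = q * (\<Sum>i=1..m. k i * x ^ (m - i))"
    unfolding sum_distrib_left using \<open>x \<noteq> 0\<close>
    by (intro sum.cong) (auto simp: power_diff power_one_over)
  also have "(\<Sum>i=1..m. k i * x ^ (m - i)) = (\<Sum>i\<le>m - 1. k (m - i) * x ^ i)"
    using \<open>0 < m\<close> by (intro sum.reindex_bij_witness[of _ "\<lambda>i. m - i" "\<lambda>i. m - i"]) auto
  finally have xm: "x ^ m = q * (\<Sum>i\<le>m - 1. k (m - i) * x ^ i)" .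
  define a' where "a' i = a i + a m * q * k (m - i)" for i
  have "(\<Sum>i\<le>m. a i * x ^ i) = (\<Sum>i\<le>m - 1. a i * x ^ i) + a m * x ^ m"
    using \<open>0 < m\<close> by (cases m) auto
  also have "\<dots> = (\<Sum>i\<le>m - 1. a' i * x ^ i)"
    unfolding xm a'_def by (simp add: sum_distrib_left sum.distrib algebra_simps)
  finally have "q * (\<Sum>i\<le>m - 1. a' i * x ^ i) = 1" using a by simp
  moreover have "a' i \<in> R" for i
    unfolding a'_def using a k q subring by (intro subring_add subring_mult) auto
  ultimately show ?thesis by blast
qed

text \<open>If both were missing, \<open>1 / q\<close> would have expansions in powers of
  \<open>x\<close> and of \<open>1 / x\<close>. Of two expansions of least degree, the one that is
  not shorter can still be shortened by means of the other.\<close>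

lemma valuation_ring: "x \<in> R \<or> 1 / x \<in> R"
proof (rule ccontr)
  assume neg: "\<not> (x \<in> R \<or> 1 / x \<in> R)"
  then have x0: "x \<noteq> 0" using subring_0[OF subring] by auto
  define E where "E y n \<longleftrightarrow> (\<exists>a :: nat \<Rightarrow> 'a. (\<forall>i. a i \<in> R) \<and> q * (\<Sum>i\<le>n. a i * y ^ i) = 1)" for y n
  have no0: "\<not> E y 0" for y
  proof
    assume "E y 0"
    then obtain b where "b \<in> R" "q * b = 1" by (auto simp: E_def)
    then show False using inv_q q by (metis nonzero_eq_divide_eq mult.commute)
  qed
  have ex: "\<exists>n. E x n" "\<exists>n. E (1 / x) n"
    using inv_q_expansion[of x] inv_q_expansion[of "1 / x"] neg unfolding E_def by blast+
  define m n where "m = (LEAST n. E x n)" and "n = (LEAST n. E (1 / x) n)"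
  have mn: "E x m" "E (1 / x) n" unfolding m_def n_def using ex by (auto intro: LeastI_ex)
  then have pos: "0 < m" "0 < n" using no0 by (auto intro!: gr0I)
  have "E x (m - 1)" if "n \<le> m"
  proof -
    obtain a b :: "nat \<Rightarrow> 'a" where "\<forall>i. a i \<in> R" "q * (\<Sum>i\<le>m. a i * x ^ i) = 1"
      "\<forall>i. b i \<in> R" "q * (\<Sum>i\<le>n. b i * (1 / x) ^ i) = 1" using mn unfolding E_def by blast
    from shorten_expansion[OF x0 this that pos(1)] show ?thesis unfolding E_def .
  qed
  moreover have "E (1 / x) (n - 1)" if "m \<le> n"
  proof -
    obtain a b :: "nat \<Rightarrow> 'a" where "\<forall>i. a i \<in> R" "q * (\<Sum>i\<le>n. a i * (1 / x) ^ i) = 1"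
      "\<forall>i. b i \<in> R" "q * (\<Sum>i\<le>m. b i * (1 / (1 / x)) ^ i) = 1" using mn unfolding E_def by auto
    from shorten_expansion[OF _ this that pos(2)] x0 show ?thesis unfolding E_def by simp
  qed
  ultimately show False
    using pos not_less_Least[of "m - 1" "E x", folded m_def]
      not_less_Least[of "n - 1" "E (1 / x)", folded n_def] by linarith
qed

end

subsection \<open>The absolute value of a valuation ring\<close>

locale valuation_subring =
  fixes R :: "'a::field set" and q :: 'a and P :: real
  assumes subring: "subring R" and q: "q \<in> R" "q \<noteq> 0" and inv_q: "1 / q \<notin> R"
    and valuation_ring: "\<And>x. x \<in> R \<or> 1 / x \<in> R"
    and P: "P > 1"
begin

text \<open>When \<open>q\<close> has value 1, a pair \<open>(a, b)\<close> records that
  \<open>a / b\<close> is a lower bound for the value of \<open>x\<close>. Comparing with powers of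
  \<open>q\<close> only yields a real absolute value whatever the value group of \<open>R\<close>
  is; it may vanish at nonzero elements.\<close>

definition approx_exponents :: "'a \<Rightarrow> (nat \<times> nat) set" where
  "approx_exponents x = {(a, b). b > 0 \<and> x ^ b / q ^ a \<in> R}"

definition absval :: "'a \<Rightarrow> real" where
  "absval x = Inf ((\<lambda>(a, b). P powr - (real a / real b)) ` approx_exponents x)"

lemma inv_q_power: "1 / q ^ Suc k \<notin> R"
proof
  assume "1 / q ^ Suc k \<in> R"
  then have "1 / q ^ Suc k * q ^ k \<in> R"
    using subring q(1) by (intro subring_mult subring_power)
  moreover have "1 / q ^ Suc k * q ^ k = 1 / q" using q(2) by simp
  ultimately show False using inv_q by simp
qed

lemma q_power_div_le:
  assumes "q ^ j / q ^ i \<in> R" shows "i \<le> j"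
proof (rule ccontr)
  assume "\<not> i \<le> j"
  then obtain k where "i = j + Suc k" by (metis add_Suc_right less_imp_Suc_add not_le)
  then have "q ^ j / q ^ i = 1 / q ^ Suc k" using q(2) by (simp add: power_add)
  with assms inv_q_power show False by simp
qed

lemma approx_exponents_trivial: "x \<in> R \<Longrightarrow> (0, 1) \<in> approx_exponents x"
  by (simp add: approx_exponents_def)

lemma absval_le:
  assumes "b > 0" and "x ^ b / q ^ a \<in> R"
  shows "absval x \<le> P powr - (real a / real b)"
  unfolding absval_def using assms
  by (intro cInf_lower bdd_belowI[of _ 0] image_eqI[of _ _ "(a, b)"]) (auto simp: approx_exponents_def)

lemma absval_greatest:
  assumes "x \<in> R" and "\<And>a b. b > 0 \<Longrightarrow> x ^ b / q ^ a \<in> R \<Longrightarrow> c \<le> P powr - (real a / real b)"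
  shows "c \<le> absval x"
  unfolding absval_def
proof (rule cInf_greatest)
  show "(\<lambda>(a, b). P powr - (real a / real b)) ` approx_exponents x \<noteq> {}"
    using approx_exponents_trivial[OF assms(1)] by blast
qed (use assms(2) in \<open>auto simp: approx_exponents_def\<close>)

lemma absval_nonneg: "x \<in> R \<Longrightarrow> 0 \<le> absval x"
  by (rule absval_greatest) auto

lemma absval_le_1: "x \<in> R \<Longrightarrow> absval x \<le> 1"
  using absval_le[of 1 x 0] P by simp

lemma absval_zero: "absval 0 = 0"
proof (rule antisym)
  have "absval 0 \<le> P powr - real n" for n
    using absval_le[of 1 0 n] subring_0[OF subring] by simp
  moreover have "(\<lambda>n. P powr - real n) \<longlonglongrightarrow> 0"
    using P by (simp add: powr_minus powr_realpow LIMSEQ_inverse_realpow_zero)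
  ultimately show "absval 0 \<le> 0"
    using tendsto_lowerbound[of "\<lambda>n. P powr - real n" 0 sequentially] by simp
qed (rule absval_nonneg[OF subring_0[OF subring]])

lemma absval_mult_le:
  assumes x: "x \<in> R" and y: "y \<in> R"
  shows "absval (x * y) \<le> absval x * absval y"
proof -
  have key: "absval (x * y) \<le> P powr - (real a / real b) * P powr - (real c / real d)"
    if ab: "b > 0" "x ^ b / q ^ a \<in> R" and cd: "d > 0" "y ^ d / q ^ c \<in> R" for a b c d
  proof -
    have "(x * y) ^ (b * d) / q ^ (a * d + c * b) = (x ^ b / q ^ a) ^ d * (y ^ d / q ^ c) ^ b"
      by (simp add: power_mult_distrib power_divide power_add mult.commute flip: power_mult)
    also have "\<dots> \<in> R" using ab cd subring by (intro subring_mult subring_power)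
    finally have "absval (x * y) \<le> P powr - (real (a * d + c * b) / real (b * d))"
      using ab cd by (intro absval_le) auto
    also have "real (a * d + c * b) / real (b * d) = real a / real b + real c / real d"
      using ab cd by (simp add: field_simps)
    also have "P powr - (real a / real b + real c / real d)
        = P powr - (real a / real b) * P powr - (real c / real d)"
      by (simp add: powr_add powr_diff powr_minus field_simps)
    finally show ?thesis .
  qed
  \<comment> \<open>The two infima are taken one after the other, by dividing by the other factor;
    \<open>absval y = 0\<close> therefore needs its own case.\<close>
  have "absval (x * y) / P powr - (real a / real b) \<le> absval y" if "b > 0" "x ^ b / q ^ a \<in> R" for a b
    using key[OF that] P by (intro absval_greatest y) (simp add: field_simps)
  then have *: "absval (x * y) \<le> absval y * P powr - (real a / real b)" if "b > 0" "x ^ b / q ^ a \<in> R" for a b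
    using that P by (simp add: divide_le_eq)
  show ?thesis
  proof (cases "absval y = 0")
    case True
    then show ?thesis using *[of 1 0] x by simp
  next
    case False
    then have "absval y > 0" using absval_nonneg[OF y] by simp
    then have "absval (x * y) / absval y \<le> absval x"
      using * by (intro absval_greatest x) (simp add: field_simps)
    then show ?thesis using \<open>absval y > 0\<close> by (simp add: field_simps)
  qed
qed

text \<open>In a valuation ring, if \<open>q ^ c\<close> does not divide \<open>x ^ n\<close> then \<open>x ^ n\<close> divides \<open>q ^ c\<close>;
  this turns upper bounds on the valuation into divisibilities.\<close>

lemma absval_pos_dvd_power:
  assumes x: "x \<in> R" and pos: "absval x > 0"
  obtains c where "q ^ c / x ^ n \<in> R" and "real c \<le> - real n * log P (absval x) + 1"
proof -
  define v where "v = - log P (absval x)"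
  have v: "absval x = P powr - v" "v \<ge> 0"
    using pos P absval_le_1[OF x] by (auto simp: v_def zero_le_log_cancel_iff)
  \<comment> \<open>The least integer exceeding \<open>n * v\<close>: with it,
    \<open>x ^ n / q ^ c \<in> R\<close> would contradict the value \<open>v\<close> of
    \<open>x\<close>.\<close>
  define c where "c = nat \<lfloor>real n * v\<rfloor> + 1"
  have c: "real c > real n * v" "real c \<le> real n * v + 1"
    using v unfolding c_def by (auto simp: of_nat_nat floor_less_cancel)
  have "q ^ c / x ^ n \<in> R"
  proof (cases "n = 0")
    case True
    then show ?thesis using q subring by (auto intro: subring_power)
  next
    case False
    have "x ^ n / q ^ c \<notin> R"
    proof
      assume "x ^ n / q ^ c \<in> R"
      then have "P powr - v \<le> P powr - (real c / real n)"
        using absval_le[of n x c] False v by simp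
      then have "real c / real n \<le> v" using P by (simp add: powr_le_cancel_iff)
      then show False using c False by (simp add: field_simps)
    qed
    then show ?thesis using valuation_ring[of "x ^ n / q ^ c"] by simp
  qed
  then show thesis using c by (intro that[of c]) (auto simp: v_def)
qed

text \<open>For the missing inequality, \<open>x ^ n\<close> and \<open>y ^ n\<close> divide powers
  of \<open>q\<close> whose exponents exceed \<open>n\<close> times their values by at most 1. A
  lower bound \<open>a / b\<close> for the value of \<open>x * y\<close> then compares two powers of
  \<open>q\<close>, with an error \<open>2 / n\<close> that vanishes in the limit.\<close>

lemma absval_mult:
  assumes x: "x \<in> R" and y: "y \<in> R"
  shows "absval (x * y) = absval x * absval y"
proof (cases "absval x * absval y = 0")
  case True
  then show ?thesis
    using absval_mult_le[OF x y] absval_nonneg[OF subring_mult[OF subring x y]] by linarith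
next
  case False
  then have pos: "absval x > 0" "absval y > 0" using absval_nonneg x y by (auto simp: less_le)
  define v where "v = - log P (absval x) - log P (absval y)"
  have "P powr - v \<le> P powr - (real a / real b)" if ab: "b > 0" "(x * y) ^ b / q ^ a \<in> R" for a b
  proof -
    have "real a / real b \<le> v + 2 / real n" if "n > 0" for n
    proof -
      obtain c where c: "q ^ c / x ^ n \<in> R" "real c \<le> - real n * log P (absval x) + 1"
        using absval_pos_dvd_power[OF x pos(1)] by blast
      obtain d where d: "q ^ d / y ^ n \<in> R" "real d \<le> - real n * log P (absval y) + 1"
        using absval_pos_dvd_power[OF y pos(2)] by blast
      have nz: "x \<noteq> 0" "y \<noteq> 0"
        using pos absval_zero by auto
      have "q ^ ((c + d) * b) / q ^ (a * n)
          = ((x * y) ^ b / q ^ a) ^ n * (q ^ c / x ^ n) ^ b * (q ^ d / y ^ n) ^ b"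
        using nz by (simp add: power_mult_distrib power_divide power_add mult.commute field_simps flip: power_mult)
      also have "\<dots> \<in> R" using ab c d subring by (intro subring_mult subring_power)
      finally have "a * n \<le> (c + d) * b" by (rule q_power_div_le)
      then have "real a * real n \<le> (real c + real d) * real b"
        by (metis of_nat_add of_nat_le_iff of_nat_mult)
      then have "real a / real b \<le> (real c + real d) / real n"
        using \<open>b > 0\<close> \<open>n > 0\<close> by (simp add: field_simps)
      also have "\<dots> \<le> (real n * v + 2) / real n"
        using c(2) d(2) by (intro divide_right_mono) (auto simp: v_def algebra_simps)
      also have "\<dots> = v + 2 / real n" using \<open>n > 0\<close> by (simp add: field_simps)
      finally show ?thesis .
    qed
    then have "\<forall>\<^sub>F n in sequentially. real a / real b \<le> v + 2 / real n"
      by (intro eventually_sequentiallyI[of 1]) auto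
    moreover have "(\<lambda>n. v + 2 / real n) \<longlonglongrightarrow> v + 0"
      by (intro tendsto_intros lim_const_over_n)
    ultimately have "real a / real b \<le> v"
      using tendsto_lowerbound[of "\<lambda>n. v + 2 / real n" v sequentially] by simp
    then show ?thesis using P by simp
  qed
  then have "P powr - v \<le> absval (x * y)"
    using x y subring by (intro absval_greatest subring_mult)
  moreover have "P powr - v = absval x * absval y"
    unfolding v_def using pos P by (simp add: powr_add)
  ultimately show ?thesis using absval_mult_le[OF x y] by simp
qed

lemma absval_q: "absval q = 1 / P"
proof (rule antisym)
  show "absval q \<le> 1 / P"
    using absval_le[of 1 q 1] q subring_1[OF subring] P by (simp add: powr_minus field_simps)
  show "1 / P \<le> absval q"
  proof (rule absval_greatest[OF q(1)])
    fix a b :: nat assume ab: "b > 0" "q ^ b / q ^ a \<in> R"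
    then have le: "real a / real b \<le> 1" using q_power_div_le[of b a] by simp
    have "1 / P = P powr - 1" using P by (simp add: powr_minus_divide)
    also have "\<dots> \<le> P powr - (real a / real b)" using P le by (intro powr_mono) auto
    finally show "1 / P \<le> P powr - (real a / real b)" .
  qed
qed

text \<open>One of \<open>x\<close>, \<open>y\<close> divides the other in \<open>R\<close>;
  factoring out the divisor leaves an element of \<open>R\<close>, of absolute value at most
  1.\<close>

lemma absval_add:
  assumes "x \<in> R" "y \<in> R"
  shows "absval (x + y) \<le> max (absval x) (absval y)"
proof -
  have *: "absval (x + y) \<le> absval x" if "x \<in> R" "y / x \<in> R" "x \<noteq> 0" for x y
  proof -
    have "x + y = x * (1 + y / x)" using that by (simp add: distrib_left)
    then have "absval (x + y) = absval (x * (1 + y / x))" by simp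
    also have "\<dots> \<le> absval x * absval (1 + y / x)"
      using that subring by (intro absval_mult_le subring_add subring_1)
    also have "\<dots> \<le> absval x * 1"
      using that subring absval_nonneg by (intro mult_left_mono absval_le_1 subring_add subring_1)
    finally show ?thesis by simp
  qed
  show ?thesis
  proof (cases "x = 0 \<or> y = 0")
    case False
    then have "absval (x + y) \<le> absval x \<or> absval (y + x) \<le> absval y"
      using *[of x y] *[of y x] assms valuation_ring[of "y / x"] by auto
    then show ?thesis by (auto simp: add.commute)
  qed auto
qed

text \<open>If \<open>x\<close> were outside \<open>R\<close>, then \<open>1 / x\<close> would be in
  \<open>R\<close>, and dividing the equation by \<open>x ^ (n - 1)\<close> would write
  \<open>x\<close> as a polynomial in \<open>1 / x\<close>.\<close>

lemma integrally_closed: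
  assumes monic: "lead_coeff h = 1" and coeffs: "\<And>i. coeff h i \<in> R" and root: "poly h x = 0"
  shows "x \<in> R"
proof (rule ccontr)
  assume neg: "x \<notin> R"
  then have y: "1 / x \<in> R" and x0: "x \<noteq> 0" using valuation_ring subring_0[OF subring] by auto
  define n where "n = degree h"
  have "n > 0"
  proof (rule gr0I)
    assume "n = 0"
    then have "h = 1" using monic unfolding n_def by (metis degree_eq_zeroE lead_coeff_pCons(2) one_pCons coeff_pCons_0)
    with root show False by simp
  qed
  have "0 = (\<Sum>i\<le>n. coeff h i * x ^ i)" using root by (simp add: poly_altdef n_def)
  also have "\<dots> = (\<Sum>i<n. coeff h i * x ^ i) + x ^ n"
    using monic by (simp add: lessThan_Suc_atMost[symmetric] n_def)
  finally have "x ^ n = - (\<Sum>i<n. coeff h i * x ^ i)" by (simp add: eq_neg_iff_add_eq_0 add.commute)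
  then have "x ^ n / x ^ (n - 1) = - (\<Sum>i<n. coeff h i * (x ^ i / x ^ (n - 1)))"
    by (simp add: sum_divide_distrib)
  moreover have "x ^ n / x ^ (n - 1) = x"
    using x0 \<open>n > 0\<close> by (cases n) auto
  moreover have "(\<Sum>i<n. coeff h i * (x ^ i / x ^ (n - 1))) = (\<Sum>i<n. coeff h i * (1 / x) ^ (n - 1 - i))"
    using x0 by (intro sum.cong) (auto simp: power_diff power_one_over)
  ultimately have "x = - (\<Sum>i<n. coeff h i * (1 / x) ^ (n - 1 - i))"
    by (simp only:)
  also have "\<dots> \<in> R"
    using coeffs y subring by (intro subring_uminus subring_sum subring_mult subring_power)
  finally show False using neg by simp
qed

end

subsection \<open>The resultant as a product over roots\<close>

lemma poly_prod_mset_linear: "poly (\<Prod>x\<in>#A. [:- x, 1:]) y = (\<Prod>x\<in>#A. y - x)"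
  for y :: "'a::comm_ring_1"
  by (induction A) (auto simp: algebra_simps)

lemma degree_prod_mset_linear: "degree (\<Prod>x\<in>#A. [:- x, 1:]) = size A"
  for A :: "'a::idom multiset"
proof (induction A)
  case (add x A)
  have "(\<Prod>x\<in>#A. [:- x, 1:]) \<noteq> 0" by (auto simp: prod_mset_zero_iff)
  then have "degree ([:- x, 1:] * (\<Prod>x\<in>#A. [:- x, 1:])) = 1 + degree (\<Prod>x\<in>#A. [:- x, 1:])"
    by (subst degree_mult_eq) auto
  then show ?case using add by (simp only: image_mset_add_mset prod_mset.add_mset size_add_mset)
qed simp

lemma prod_mset_minus_swap:
  "(\<Prod>x\<in>#A. \<Prod>y\<in>#B. x - y) = (- 1) ^ (size A * size B) * (\<Prod>y\<in>#B. \<Prod>x\<in>#A. y - x)"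
  for A :: "'a::comm_ring_1 multiset"
proof -
  have *: "(\<Prod>y\<in>#B. x - y) = (- 1) ^ size B * (\<Prod>y\<in>#B. y - x)" for x
    by (induction B) (auto simp: algebra_simps)
  have "(\<Prod>x\<in>#A. \<Prod>y\<in>#B. x - y) = (- 1) ^ (size A * size B) * (\<Prod>x\<in>#A. \<Prod>y\<in>#B. y - x)"
    by (induction A) (auto simp: * power_add algebra_simps)
  also have "(\<Prod>x\<in>#A. \<Prod>y\<in>#B. y - x) = (\<Prod>y\<in>#B. \<Prod>x\<in>#A. y - x)"
    by (induction A) (auto simp: prod_mset.distrib)
  finally show ?thesis .
qed

lemma prod_mset_mult_const: "(\<Prod>x\<in>#A. c * h x) = c ^ size A * (\<Prod>x\<in>#A. h x)"
  for c :: "'a::comm_semiring_1"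
  by (induction A) (auto simp: algebra_simps)

lemma minus_one_power_cancel: "(- 1) ^ n * ((- 1) ^ n * z) = z" for z :: "'a::comm_ring_1"
  by (simp flip: mult.assoc power_mult_distrib)

text \<open>Euclid's algorithm: \<open>F\<close> and its remainder modulo \<open>G\<close> agree at
  the roots of \<open>G\<close>, and the resultant changes under this replacement by a known power
  of the leading coefficient and a sign.\<close>

lemma resultant_eq_prod_roots:
  fixes F G :: "'a::alg_closed_field poly"
  assumes "F \<noteq> 0" "G \<noteq> 0" and "G = smult (lead_coeff G) (\<Prod>x\<in>#B. [:- x, 1:])"
  shows "resultant F G = (- 1) ^ (degree F * degree G) * lead_coeff G ^ degree F * (\<Prod>y\<in>#B. poly F y)"
  using assms
\<comment> \<open>A swap keeps the degree sum and clears the indicator. A remainder lowers the sum,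
  and the factor 2 outweighs the indicator that may reappear.\<close>
proof (induction "2 * (degree F + degree G) + (if degree F < degree G then 1 else 0)"
    arbitrary: F G B rule: less_induct)
  case less
  note F = less.prems(1) and G = less.prems(2) and GB = less.prems(3)
  have sizeB: "size B = degree G"
    using arg_cong[OF GB, of degree] G degree_prod_mset_linear[of B] by (simp del: mult_pCons_left)
  obtain A where A: "size A = degree F" "F = smult (lead_coeff F) (\<Prod>x\<in>#A. [:-x, 1:])"
    using alg_closed_imp_factorization[OF F] by blast
  have polyF: "poly F y = lead_coeff F * (\<Prod>x\<in>#A. y - x)" for y
    using arg_cong[OF A(2), of "\<lambda>p. poly p y"] by (simp only: poly_smult poly_prod_mset_linear)
  have polyG: "poly G y = lead_coeff G * (\<Prod>x\<in>#B. y - x)" for y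
    using arg_cong[OF GB, of "\<lambda>p. poly p y"] by (simp only: poly_smult poly_prod_mset_linear)
  consider "degree F < degree G" | "degree G \<le> degree F" "degree G = 0" | "degree G \<le> degree F" "degree G > 0"
    by linarith
  then show ?case
  proof cases
    case 1
    have "resultant F G = (-1) ^ (degree F * degree G) * resultant G F" by (rule resultant_swap)
    also have "resultant G F = (- 1) ^ (degree G * degree F) * lead_coeff F ^ degree G * (\<Prod>x\<in>#A. poly G x)"
      using 1 by (intro less.hyps F G A(2)) auto
    also have "(-1) ^ (degree F * degree G) * \<dots> = lead_coeff F ^ degree G * (\<Prod>x\<in>#A. poly G x)"
      by (simp only: mult.commute[of "degree G"] mult.assoc minus_one_power_cancel)
    also have "(\<Prod>x\<in>#A. poly G x) = lead_coeff G ^ degree F * (\<Prod>x\<in>#A. \<Prod>y\<in>#B. x - y)"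
      unfolding polyG prod_mset_mult_const A(1) ..
    also have "(\<Prod>x\<in>#A. \<Prod>y\<in>#B. x - y) = (- 1) ^ (degree F * degree G) * (\<Prod>y\<in>#B. \<Prod>x\<in>#A. y - x)"
      using prod_mset_minus_swap[of B A] unfolding A(1) sizeB .
    also have "lead_coeff F ^ degree G * (lead_coeff G ^ degree F * \<dots>) =
        (- 1) ^ (degree F * degree G) * lead_coeff G ^ degree F *
          (lead_coeff F ^ size B * (\<Prod>y\<in>#B. \<Prod>x\<in>#A. y - x))"
      unfolding sizeB by (simp add: algebra_simps)
    also have "lead_coeff F ^ size B * (\<Prod>y\<in>#B. \<Prod>x\<in>#A. y - x) = (\<Prod>y\<in>#B. poly F y)"
      unfolding polyF prod_mset_mult_const ..
    finally show ?thesis .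
  next
    case 2
    then obtain c where "G = [:c:]" by (auto elim: degree_eq_zeroE)
    then show ?thesis using sizeB by simp
  next
    case 3
    define H where "H = F mod G"
    have FGH: "F + (- (F div G)) * G = H"
      unfolding H_def by (simp add: algebra_simps minus_div_mult_eq_mod)
    have dH: "degree H < degree G"
      using 3 degree_mod_less'[of G F] G unfolding H_def by (cases "F mod G = 0") auto
    have polyH: "poly H y = poly F y" if "y \<in># B" for y
    proof -
      have "poly G y = 0" using that unfolding polyG by auto
      then show ?thesis using FGH by (metis add_0_right mult_zero_right poly_add poly_mult)
    qed
    have prodH: "(\<Prod>y\<in>#B. poly F y) = (\<Prod>y\<in>#B. poly H y)"
      using polyH by (intro arg_cong[of _ _ prod_mset] image_mset_cong) simp
    note BT = FGH 3(1)
    show ?thesis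
    proof (cases "degree H = 0")
      \<comment> \<open>A constant remainder, zero included, ends the recursion.\<close>
      case True
      then obtain c where c: "H = [:c:]" by (auto elim: degree_eq_zeroE)
      have "subresultant 0 F G = smult ((-1)^((degree F - degree H) * (degree G - degree H)) *
          lead_coeff G ^ (degree F - degree H) * lead_coeff H ^ (degree G - degree H - 1)) H"
        using BT_lemma_1_13'[OF FGH 3(1), of 0] dH True by simp
      then have "resultant F G = (- 1) ^ (degree F * degree G) * lead_coeff G ^ degree F * (c ^ (degree G - 1) * c)"
        unfolding subresultant_resultant using c by simp
      moreover have "c ^ (degree G - 1) * c = c ^ degree G" using 3 by (cases "degree G") auto
      moreover have "poly H = (\<lambda>_. c)" unfolding c by (rule ext) simp
      then have "c ^ degree G = (\<Prod>y\<in>#B. poly F y)" unfolding prodH using sizeB by simp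
      ultimately show ?thesis by simp
    next
      case False
      then have "H \<noteq> 0" by auto
      have "subresultant 0 F G = smult ((-1)^(degree F * degree G) * lead_coeff G ^ (degree F - degree H)) (subresultant 0 G H)"
        using BT_lemma_1_12[OF FGH 3(1), of 0] dH False by simp
      then have "resultant F G = (-1)^(degree F * degree G) * lead_coeff G ^ (degree F - degree H) * resultant G H"
        unfolding subresultant_resultant by simp
      also have "resultant G H = (-1)^(degree G * degree H) * resultant H G" by (rule resultant_swap)
      also have "resultant H G = (- 1) ^ (degree H * degree G) * lead_coeff G ^ degree H * (\<Prod>y\<in>#B. poly H y)"
        using dH 3 by (intro less.hyps[OF _ \<open>H \<noteq> 0\<close> G GB]) auto
      also have "(-1) ^ (degree G * degree H) * \<dots> = lead_coeff G ^ degree H * (\<Prod>y\<in>#B. poly H y)"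
        by (simp only: mult.commute[of "degree G"] mult.assoc minus_one_power_cancel)
      also have "(-1) ^ (degree F * degree G) * lead_coeff G ^ (degree F - degree H) * \<dots> =
          (-1) ^ (degree F * degree G) * (lead_coeff G ^ (degree F - degree H) * lead_coeff G ^ degree H) *
            (\<Prod>y\<in>#B. poly H y)"
        by (simp only: mult.assoc)
      also have "lead_coeff G ^ (degree F - degree H) * lead_coeff G ^ degree H = lead_coeff G ^ degree F"
        using dH 3 by (simp flip: power_add)
      finally show ?thesis unfolding prodH .
    qed
  qed
qed

subsection \<open>Newton expansions and counting multiples\<close>

text \<open>Blocks of length \<open>m\<close> starting at the multiples of \<open>m\<close>, the
  first one at 0, cover the numbers below \<open>k\<close>; the count rounds \<open>k / m\<close>
  up.\<close>

lemma le_mult_card_dvd_lessThan: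
  assumes "m > (0::nat)"
  shows "k \<le> m * card {i. i < k \<and> m dvd i}"
proof -
  define S where "S = {i. i < k \<and> m dvd i}"
  have fin: "finite S" by (auto simp: S_def)
  have "{..<k} \<subseteq> (\<Union>i\<in>S. {i..<i + m})"
  proof
    fix j assume "j \<in> {..<k}"
    then have "m * (j div m) < k"
      by (metis lessThan_iff mult.commute div_times_less_eq_dividend le_less_trans)
    moreover have "m * (j div m) \<le> j" by simp
    moreover have "j < m * (j div m) + m"
      using assms by (metis add.commute dividend_less_times_div mult_Suc_right)
    ultimately have "m * (j div m) \<in> S" "j \<in> {m * (j div m)..<m * (j div m) + m}"
      unfolding S_def by simp_all
    then show "j \<in> (\<Union>i\<in>S. {i..<i + m})" by blast
  qed
  then have "card {..<k} \<le> card (\<Union>i\<in>S. {i..<i + m})" using fin by (intro card_mono) auto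
  also have "\<dots> \<le> (\<Sum>i\<in>S. card {i..<i + m})" by (rule card_UN_le[OF fin])
  finally show ?thesis by (simp add: S_def mult.commute)
qed

lemma card_dvd_atLeastAtMost:
  assumes "m > (0::nat)"
  shows "card {i \<in> {1..k}. m dvd i} = k div m"
proof -
  have "{i \<in> {1..k}. m dvd i} = (*) m ` {1..k div m}"
    using assms by (auto simp: less_eq_div_iff_mult_less_eq mult.commute elim!: dvdE)
  then show ?thesis using assms by (simp add: card_image inj_on_def)
qed

lemma card_residue_class_le:
  assumes "m > (0::nat)" and "m dvd n"
  shows "card {c. c < n \<and> int m dvd int c - c0} \<le> n div m"
proof -
  have "inj_on (\<lambda>c. c div m) {c. c < n \<and> int m dvd int c - c0}"
  proof (rule inj_onI)
    fix a b assume *: "a \<in> {c. c < n \<and> int m dvd int c - c0}" "b \<in> {c. c < n \<and> int m dvd int c - c0}"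
      and div: "a div m = b div m"
    have "int m dvd (int a - c0) - (int b - c0)" using * dvd_diff[of "int m" "int a - c0" "int b - c0"] by blast
    then have "int a mod int m = int b mod int m" by (simp add: mod_eq_dvd_iff)
    then have "a mod m = b mod m" by (metis of_nat_eq_iff zmod_int)
    with div show "a = b" by (metis mult_div_mod_eq)
  qed
  moreover have "(\<lambda>c. c div m) ` {c. c < n \<and> int m dvd int c - c0} \<subseteq> {..<n div m}"
    using assms by (auto simp: less_mult_imp_div_less mult.commute elim!: dvdE)
  ultimately show ?thesis using card_inj_on_le[of _ _ "{..<n div m}"] by fastforce
qed

section \<open>Falling factorials and Newton's expansion\<close>

definition ffact_poly :: "nat \<Rightarrow> int poly" where
  "ffact_poly k = (\<Prod>i<k. [:- int i, 1:])"

lemma degree_ffact_poly: "degree (ffact_poly k) = k"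
  and lead_coeff_ffact_poly: "lead_coeff (ffact_poly k) = 1"
proof -
  have "degree (ffact_poly k) = k \<and> lead_coeff (ffact_poly k) = 1"
  proof (induction k)
    case (Suc k)
    have nz: "ffact_poly k \<noteq> 0" using Suc by auto
    have eq: "ffact_poly (Suc k) = ffact_poly k * [:- int k, 1:]"
      by (simp add: ffact_poly_def mult.commute del: mult_pCons_right mult_pCons_left)
    have "degree (ffact_poly (Suc k)) = Suc k"
      unfolding eq using nz Suc by (subst degree_mult_eq) auto
    moreover have "lead_coeff (ffact_poly (Suc k)) = 1"
      unfolding eq lead_coeff_mult by (simp only: Suc[THEN conjunct2]) simp
    ultimately show ?case by blast
  qed (simp add: ffact_poly_def)
  then show "degree (ffact_poly k) = k" "lead_coeff (ffact_poly k) = 1" by auto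
qed

text \<open>The falling factorials are monic, so the top term can be removed without leaving the
  integers.\<close>

lemma newton_expansion:
  "degree h \<le> n \<Longrightarrow> \<exists>c. h = (\<Sum>k\<le>n. smult (c k) (ffact_poly k))"
proof (induction n arbitrary: h)
  case 0
  then obtain a where "h = [:a:]" by (auto elim: degree_eq_zeroE)
  then show ?case by (auto intro!: exI[of _ "\<lambda>_. a"] simp: ffact_poly_def)
next
  case (Suc n)
  define h' where "h' = h - smult (coeff h (Suc n)) (ffact_poly (Suc n))"
  have "degree h' \<le> n"
  proof (rule degree_le, intro allI impI)
    fix i assume "n < i"
    then consider "i = Suc n" | "i > Suc n" by linarith
    then show "coeff h' i = 0"
    proof cases
      case 1
      then show ?thesis
        using degree_ffact_poly[of "Suc n"] lead_coeff_ffact_poly[of "Suc n"] by (simp add: h'_def)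
    next
      case 2
      then show ?thesis
        using degree_ffact_poly[of "Suc n"] Suc.prems by (simp add: h'_def coeff_eq_0)
    qed
  qed
  then obtain c where "h' = (\<Sum>k\<le>n. smult (c k) (ffact_poly k))" using Suc.IH by blast
  then have "h = (\<Sum>k\<le>n. smult (c k) (ffact_poly k)) + smult (coeff h (Suc n)) (ffact_poly (Suc n))"
    by (simp add: h'_def)
  also have "\<dots> = (\<Sum>k\<le>Suc n. smult ((c(Suc n := coeff h (Suc n))) k) (ffact_poly k))"
    by simp
  finally show ?case by blast
qed

lemma poly_ffact_poly: "poly (ffact_poly k) x = (\<Prod>i<k. x - int i)"
  by (simp add: ffact_poly_def poly_prod)

lemma poly_ffact_poly_nat: "poly (ffact_poly k) (int n) = fact k * int (n choose k)"
proof -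
  have "real_of_int (\<Prod>i<k. int n - int i) = (\<Prod>i=0..<k. real n - real i)"
    by (simp add: lessThan_atLeast0)
  also have "\<dots> = fact k * (real n gchoose k)"
    using gbinomial_mult_fact[of k "real n"] by simp
  also have "\<dots> = real_of_int (fact k * int (n choose k))"
    by (simp flip: binomial_gbinomial)
  finally show ?thesis unfolding poly_ffact_poly by (simp only: of_int_eq_iff)
qed

text \<open>\<open>c k * fact k\<close> is the \<open>k\<close>-th difference of \<open>h\<close> at
  0, an integer combination of values of \<open>h\<close>; the induction solves the triangular
  system for it.\<close>

lemma dvd_newton_coeff_mult_fact:
  fixes m :: int
  assumes h: "h = (\<Sum>k\<le>d. smult (c k) (ffact_poly k))" and dvd: "\<And>n. m dvd poly h n" and "k \<le> d"
  shows "m dvd c k * fact k"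
  using \<open>k \<le> d\<close>
proof (induction k rule: less_induct)
  case (less n)
  have "poly h (int n) = (\<Sum>k\<le>d. c k * fact k * int (n choose k))"
    by (simp add: h poly_sum poly_ffact_poly_nat mult.assoc)
  also have "\<dots> = (\<Sum>k\<le>n. c k * fact k * int (n choose k))"
    using less.prems by (intro sum.mono_neutral_right) auto
  also have "\<dots> = (\<Sum>k<n. c k * fact k * int (n choose k)) + c n * fact n"
    by (simp add: lessThan_Suc_atMost[symmetric])
  finally have "c n * fact n = poly h (int n) - (\<Sum>k<n. c k * fact k * int (n choose k))" by simp
  moreover have "m dvd (\<Sum>k<n. c k * fact k * int (n choose k))"
    using less by (intro dvd_sum) auto
  ultimately show ?case using dvd by simp
qed

section \<open>Truncated valuations and their averages over residues\<close>

locale prime_level =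
  fixes p L :: nat
  assumes p: "prime p"
begin

text \<open>By \<open>mu_cases\<close>, \<open>mu l i\<close> is the minimum of \<open>l\<close>, \<open>L\<close> and the \<open>p\<close>-adic valuation of \<open>i\<close>;
  \<open>phi l\<close> is its average over the residues modulo \<open>p ^ L\<close>, and \<open>delta l t\<close> the length of the part
  of the interval from \<open>t - 1\<close> to \<open>t\<close> below \<open>l\<close>.\<close>

definition delta :: "real \<Rightarrow> nat \<Rightarrow> real" where
  "delta l t = min l (real t) - min l (real t - 1)"

definition mu :: "real \<Rightarrow> int \<Rightarrow> real" where
  "mu l i = (\<Sum>t=1..L. if int p ^ t dvd i then delta l t else 0)"

definition phi :: "real \<Rightarrow> real" where
  "phi l = (\<Sum>t=1..L. delta l t / real p ^ t)"

definition theta :: real where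
  "theta = (\<Sum>t=1..L. 1 / real p ^ t)"

lemma delta_nonneg: "0 \<le> delta l t"
  and delta_le_1: "delta l t \<le> 1"
  by (auto simp: delta_def)

lemma p_pos: "p > 0" and p_gt_1: "p > 1"
  using p prime_gt_0_nat prime_gt_1_nat by auto

lemma sum_delta: "0 \<le> l \<Longrightarrow> (\<Sum>t=1..T. delta l t) = min l (real T)"
  by (induction T) (auto simp: delta_def)

text \<open>\<open>T\<close> is the valuation of \<open>i\<close> capped at \<open>L\<close>.
  Phrasing it by divisibility covers \<open>i = 0\<close>, where \<open>T = L\<close>.\<close>

lemma mu_cases:
  assumes "0 \<le> l"
  obtains T where "T \<le> L" and "int p ^ T dvd i" and "T = L \<or> \<not> int p ^ Suc T dvd i"
    and "mu l i = min l (real T)"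
proof -
  define T where "T = (GREATEST t. t \<le> L \<and> int p ^ t dvd i)"
  have T: "T \<le> L" "int p ^ T dvd i"
    using GreatestI_nat[of "\<lambda>t. t \<le> L \<and> int p ^ t dvd i" 0 L] unfolding T_def by auto
  have max: "t \<le> T" if "t \<le> L" "int p ^ t dvd i" for t
    using Greatest_le_nat[of "\<lambda>t. t \<le> L \<and> int p ^ t dvd i" t L] that unfolding T_def by auto
  have "int p ^ t dvd i \<longleftrightarrow> t \<le> T" if "t \<le> L" for t
    using max[OF that] T dvd_trans[OF le_imp_power_dvd] by blast
  then have "mu l i = (\<Sum>t=1..L. if t \<le> T then delta l t else 0)"
    unfolding mu_def by (intro sum.cong) auto
  also have "\<dots> = (\<Sum>t=1..T. delta l t)"
    using T(1) by (intro sum.mono_neutral_cong_right) auto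
  finally have "mu l i = min l (real T)" using sum_delta[OF assms] by simp
  moreover have "T = L \<or> \<not> int p ^ Suc T dvd i"
    using max[of "Suc T"] T(1) by auto
  ultimately show thesis using that T by blast
qed

text \<open>At least \<open>k / p ^ t\<close> of the first \<open>k\<close> naturals are multiples
  of \<open>p ^ t\<close>. This bounds the valuation of a falling factorial of length
  \<open>k\<close> from below.\<close>

lemma sum_mu_ge: "real k * phi l \<le> (\<Sum>i<k. mu l (int i))"
proof -
  have "real k * phi l = (\<Sum>t=1..L. delta l t * (real k / real p ^ t))"
    by (simp add: phi_def sum_distrib_left mult.commute)
  also have "\<dots> \<le> (\<Sum>t=1..L. delta l t * real (card {i. i < k \<and> p ^ t dvd i}))"
  proof (intro sum_mono mult_left_mono delta_nonneg)
    fix t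
    have "real k \<le> real (p ^ t * card {i. i < k \<and> p ^ t dvd i})"
      using p_pos by (intro of_nat_mono le_mult_card_dvd_lessThan) simp
    then show "real k / real p ^ t \<le> real (card {i. i < k \<and> p ^ t dvd i})"
      using p_pos by (simp add: field_simps)
  qed
  also have "\<dots> = (\<Sum>t=1..L. \<Sum>i<k. if int p ^ t dvd int i then delta l t else 0)"
  proof (intro sum.cong refl)
    fix t
    have "(\<Sum>i<k. if int p ^ t dvd int i then delta l t else 0) = (\<Sum>i\<in>{i. i < k \<and> p ^ t dvd i}. delta l t)"
      by (intro sum.mono_neutral_cong_right) (auto simp flip: of_nat_power)
    then show "delta l t * real (card {i. i < k \<and> p ^ t dvd i})
        = (\<Sum>i<k. if int p ^ t dvd int i then delta l t else 0)" by simp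
  qed
  also have "\<dots> = (\<Sum>i<k. mu l (int i))" unfolding mu_def by (rule sum.swap)
  finally show ?thesis .
qed

text \<open>A class modulo \<open>p ^ t\<close> contains at most \<open>p ^ (L - t)\<close> of the
  numbers below \<open>p ^ L\<close>.\<close>

lemma sum_mu_residues_le: "(\<Sum>c<p ^ L. mu l (int c - c0)) \<le> real p ^ L * phi l"
proof -
  have "(\<Sum>c<p ^ L. mu l (int c - c0)) = (\<Sum>t=1..L. \<Sum>c<p ^ L. if int p ^ t dvd int c - c0 then delta l t else 0)"
    unfolding mu_def by (rule sum.swap)
  also have "\<dots> = (\<Sum>t=1..L. delta l t * real (card {c. c < p ^ L \<and> int (p ^ t) dvd int c - c0}))"
  proof (intro sum.cong refl)
    fix t
    have "(\<Sum>c<p ^ L. if int p ^ t dvd int c - c0 then delta l t else 0)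
        = (\<Sum>c\<in>{c. c < p ^ L \<and> int (p ^ t) dvd int c - c0}. delta l t)"
      by (intro sum.mono_neutral_cong_right) auto
    then show "(\<Sum>c<p ^ L. if int p ^ t dvd int c - c0 then delta l t else 0)
        = delta l t * real (card {c. c < p ^ L \<and> int (p ^ t) dvd int c - c0})" by simp
  qed
  also have "\<dots> \<le> (\<Sum>t=1..L. delta l t * (real p ^ L / real p ^ t))"
  proof (intro sum_mono mult_left_mono delta_nonneg)
    fix t assume t: "t \<in> {1..L}"
    then have dvd: "p ^ t dvd p ^ L" by (intro le_imp_power_dvd) auto
    have "card {c. c < p ^ L \<and> int (p ^ t) dvd int c - c0} \<le> p ^ L div p ^ t"
      using p_pos dvd by (intro card_residue_class_le) auto
    then have "real (card {c. c < p ^ L \<and> int (p ^ t) dvd int c - c0}) \<le> real (p ^ L div p ^ t)"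
      by (rule of_nat_mono)
    also have "\<dots> = real p ^ L / real p ^ t" using dvd by (simp add: real_of_nat_div)
    finally show "real (card {c. c < p ^ L \<and> int (p ^ t) dvd int c - c0}) \<le> real p ^ L / real p ^ t" .
  qed
  also have "\<dots> = real p ^ L * phi l"
    by (simp add: phi_def sum_distrib_left algebra_simps)
  finally show ?thesis .
qed

lemma phi_nonneg: "0 \<le> phi l"
  unfolding phi_def by (intro sum_nonneg divide_nonneg_nonneg delta_nonneg) auto

lemma phi_le_theta: "phi l \<le> theta"
  unfolding phi_def theta_def by (intro sum_mono divide_right_mono delta_le_1) auto

lemma phi_L: "phi (real L) = theta"
  unfolding phi_def theta_def by (intro sum.cong) (auto simp: delta_def)

lemma theta_closed_form: "theta * (real p - 1) = 1 - 1 / real p ^ L"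
  unfolding theta_def using p_pos
  by (induction L) (auto simp: field_simps)

lemma theta_pos: "L > 0 \<Longrightarrow> theta > 0"
  unfolding theta_def using p_pos by (intro sum_pos) auto

text \<open>By the geometric series the hypothesis says \<open>s < 1 + p + ... + p ^ L\<close>,
  while the right-hand side is \<open>p + ... + p ^ L\<close>. Hence every \<open>k\<close> with
  \<open>k * theta < s\<close> is below \<open>p ^ Suc L\<close>.\<close>

lemma le_power_mult_theta:
  assumes "(p - 1) * s + 1 < p ^ Suc L"
  shows "real s \<le> real p ^ Suc L * theta"
proof -
  have geo: "(p - 1) * (\<Sum>t\<le>n. p ^ t) + 1 = p ^ Suc n" for n
  proof -
    obtain r where "p = Suc r" using p_pos gr0_implies_Suc by blast
    then show ?thesis by (induction n) (auto simp: algebra_simps)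
  qed
  have "(p - 1) * s < (p - 1) * (\<Sum>t\<le>L. p ^ t)"
    using assms geo[of L] by linarith
  then have "s < (\<Sum>t\<le>L. p ^ t)" by simp
  also have "\<dots> = 1 + (\<Sum>t=1..L. p ^ t)"
    by (simp add: atMost_atLeast0 sum.atLeast_Suc_atMost)
  finally have "real s \<le> (\<Sum>t=1..L. real p ^ t)"
    by (metis Suc_eq_plus1_left less_Suc_eq_le of_nat_le_iff of_nat_power of_nat_sum sum.cong)
  also have "\<dots> = (\<Sum>t=1..L. real p ^ (Suc L - t))"
    by (intro sum.reindex_bij_witness[of _ "\<lambda>t. Suc L - t" "\<lambda>t. Suc L - t"]) auto
  also have "\<dots> = real p ^ Suc L * theta"
    unfolding theta_def sum_distrib_left using p_pos by (intro sum.cong) (auto simp: power_diff)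
  finally show ?thesis .
qed

text \<open>Legendre's formula; the bound on \<open>k\<close> removes all terms beyond
  \<open>p ^ L\<close>.\<close>

lemma multiplicity_fact_le:
  assumes "k < p ^ Suc L"
  shows "real (multiplicity (int p) (fact k)) \<le> real k * theta"
proof -
  have mult: "real (multiplicity (int p) (int i)) = (\<Sum>t=1..L. if p ^ t dvd i then 1 else 0)"
    if i: "i \<in> {1..k}" for i
  proof -
    have "int p ^ t dvd int i \<longleftrightarrow> t \<le> multiplicity (int p) (int i)" for t
      using i p_gt_1 by (intro power_dvd_iff_le_multiplicity) auto
    then have *: "p ^ t dvd i \<longleftrightarrow> t \<le> multiplicity (int p) (int i)" for t
      by (metis of_nat_dvd_iff of_nat_power)
    have "multiplicity (int p) (int i) \<le> L"
    proof (rule ccontr)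
      assume "\<not> ?thesis"
      then have "p ^ Suc L dvd i" using *[of "Suc L"] by simp
      then show False using i assms dvd_imp_le[of "p ^ Suc L" i] by simp
    qed
    then have "(\<Sum>t=1..L. if p ^ t dvd i then 1 else 0) = (\<Sum>t=1..multiplicity (int p) (int i). 1 :: real)"
      unfolding * by (intro sum.mono_neutral_cong_right) auto
    then show ?thesis by simp
  qed
  have "(fact k :: int) = (\<Prod>i=1..k. int i)" by (simp add: fact_prod)
  then have "multiplicity (int p) (fact k) = (\<Sum>i=1..k. multiplicity (int p) (int i))"
    using p by (subst prime_elem_multiplicity_prod_distrib[symmetric]) auto
  then have "real (multiplicity (int p) (fact k)) = (\<Sum>i=1..k. \<Sum>t=1..L. if p ^ t dvd i then 1 else 0)"
    using mult by simp
  also have "\<dots> = (\<Sum>t=1..L. \<Sum>i=1..k. if p ^ t dvd i then 1 else 0)" by (rule sum.swap)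
  also have "\<dots> = (\<Sum>t=1..L. real (card {i \<in> {1..k}. p ^ t dvd i}))"
    by (intro sum.cong refl) (simp add: sum.If_cases Int_def)
  also have "\<dots> \<le> (\<Sum>t=1..L. real k / real p ^ t)"
  proof (rule sum_mono)
    fix t
    have "card {i \<in> {1..k}. p ^ t dvd i} = k div p ^ t"
      using p_pos by (intro card_dvd_atLeastAtMost) simp
    then show "real (card {i \<in> {1..k}. p ^ t dvd i}) \<le> real k / real p ^ t"
      using of_nat_div_le_of_nat[of k "p ^ t", where 'a = real] by simp
  qed
  also have "\<dots> = real k * theta" by (simp add: theta_def sum_distrib_left)
  finally show ?thesis .
qed

end

subsection \<open>Integer polynomials at integral points\<close>

lemma prod_mset_nonneg: "(\<And>x. x \<in># A \<Longrightarrow> 0 \<le> h x) \<Longrightarrow> 0 \<le> (\<Prod>x\<in>#A. h x)" for h :: "'a \<Rightarrow> real"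
  by (induction A) auto

lemma prod_mset_mono_nonneg:
  fixes h k :: "'a \<Rightarrow> real"
  assumes "\<And>x. x \<in># A \<Longrightarrow> 0 \<le> h x \<and> h x \<le> k x"
  shows "(\<Prod>x\<in>#A. h x) \<le> (\<Prod>x\<in>#A. k x)"
proof -
  have "0 \<le> (\<Prod>x\<in>#A. h x) \<and> (\<Prod>x\<in>#A. h x) \<le> (\<Prod>x\<in>#A. k x)"
    using assms
  proof (induction A)
    case (add x A)
    then have "0 \<le> h x" "h x \<le> k x" "0 \<le> (\<Prod>x\<in>#A. h x)" "(\<Prod>x\<in>#A. h x) \<le> (\<Prod>x\<in>#A. k x)" by auto
    then show ?case by (auto intro!: mult_mono)
  qed simp
  then show ?thesis ..
qed

lemma powr_minus_sum_mset:
  "P > 0 \<Longrightarrow> P powr - (\<Sum>x\<in>#A. h x) = (\<Prod>x\<in>#A. P powr - h x)" for P :: real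
proof (induction A)
  case (add x A)
  have "P powr - (h x + (\<Sum>x\<in>#A. h x)) = P powr - h x * P powr - (\<Sum>x\<in>#A. h x)"
    by (simp flip: powr_add)
  then show ?case using add by simp
qed simp

lemma sum_mset_sum_swap:
  "(\<Sum>x\<in>#A. \<Sum>i\<in>I. h x i) = (\<Sum>i\<in>I. \<Sum>x\<in>#A. h x i)" for h :: "'a \<Rightarrow> 'b \<Rightarrow> real"
  by (induction A) (auto simp: sum.distrib)

lemma subring_coeff_mult:
  assumes "subring R" and "\<And>i. coeff h i \<in> R" and "\<And>i. coeff k i \<in> R"
  shows "coeff (h * k) i \<in> R"
  unfolding coeff_mult using assms by (intro subring_sum subring_mult)

lemma subring_coeff_prod_mset_linear:
  assumes "subring R" and "set_mset A \<subseteq> R"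
  shows "coeff (\<Prod>x\<in>#A. [:- x, 1:]) i \<in> R"
  using assms(2)
proof (induction A arbitrary: i)
  case empty
  then show ?case using subring_0[OF assms(1)] subring_1[OF assms(1)] by simp
next
  case (add x A)
  have "coeff [:- x, 1:] j \<in> R" for j
    using add.prems subring_0[OF assms(1)] subring_1[OF assms(1)] subring_uminus[OF assms(1)]
    by (auto simp: coeff_pCons split: nat.split)
  then have "coeff ([:- x, 1:] * (\<Prod>x\<in>#A. [:- x, 1:])) i \<in> R"
    using add by (intro subring_coeff_mult assms(1)) auto
  then show ?case by (simp only: image_mset_add_mset prod_mset.add_mset)
qed

lemma lead_coeff_prod_mset_linear: "lead_coeff (\<Prod>x\<in>#A. [:- x, 1:]) = 1"
  for A :: "'a::idom multiset"
proof (induction A)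
  case (add x A)
  have "lead_coeff ([:- x, 1:] * (\<Prod>x\<in>#A. [:- x, 1:])) = 1"
    unfolding lead_coeff_mult using add by simp
  then show ?case by (simp only: image_mset_add_mset prod_mset.add_mset)
qed simp

text \<open>\<open>N\<close> is \<open>p\<close> to the minus the extended valuation. The complex
  numbers serve only as an algebraically closed field, and integral closedness puts the roots of
  monic integer polynomials into \<open>R\<close>.\<close>

locale padic_absval = prime_level p L for p L :: nat +
  fixes R :: "complex set" and N :: "complex \<Rightarrow> real"
  assumes subring: "subring R"
    and N_nonneg: "x \<in> R \<Longrightarrow> 0 \<le> N x"
    and N_le_1: "x \<in> R \<Longrightarrow> N x \<le> 1"
    and N_mult: "x \<in> R \<Longrightarrow> y \<in> R \<Longrightarrow> N (x * y) = N x * N y"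
    and N_add: "x \<in> R \<Longrightarrow> y \<in> R \<Longrightarrow> N (x + y) \<le> max (N x) (N y)"
    and N_p: "N (of_nat p) = 1 / real p"
    and integrally_closed: "lead_coeff h = 1 \<Longrightarrow> (\<And>i. coeff h i \<in> R) \<Longrightarrow> poly h x = 0 \<Longrightarrow> x \<in> R"
begin

lemmas R_closed = subring_0[OF subring] subring_1[OF subring] subring_add[OF subring]
  subring_mult[OF subring] subring_uminus[OF subring] subring_diff[OF subring]
  subring_power[OF subring] subring_sum[OF subring] subring_of_int[OF subring]

lemma of_nat_in_R: "of_nat n \<in> R"
  using R_closed(9)[of "int n"] by simp

lemma N_zero: "N 0 = 0"
proof -
  have "N 0 = N 0 / real p" using N_mult[of 0 "of_nat p"] R_closed of_nat_in_R N_p by simp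
  then have "N 0 * (real p - 1) = 0" using p_pos by (simp add: field_simps)
  then show ?thesis using p_gt_1 by simp
qed

lemma N_one: "N 1 = 1"
  using N_mult[of 1 "of_nat p"] R_closed of_nat_in_R N_p p_pos by (simp add: field_simps)

lemma N_uminus:
  assumes "x \<in> R" shows "N (- x) = N x"
proof -
  have "N (- 1) * N (- 1) = 1" using N_mult[of "- 1" "- 1"] R_closed N_one by simp
  moreover have "0 \<le> N (- 1)" using N_nonneg R_closed by simp
  ultimately have "N (- 1) = 1" by (metis abs_of_nonneg abs_mult_self_eq power2_eq_square real_sqrt_abs real_sqrt_one)
  then show ?thesis using N_mult[of "- 1" x] R_closed assms by simp
qed

lemma N_diff: "x \<in> R \<Longrightarrow> y \<in> R \<Longrightarrow> N (x - y) \<le> max (N x) (N y)"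
  using N_add[of x "- y"] N_uminus[of y] R_closed(5)[of y] by simp

lemma N_power: "x \<in> R \<Longrightarrow> N (x ^ n) = N x ^ n"
  by (induction n) (auto simp: N_one N_mult R_closed)

lemma N_prod_mset: "(\<And>x. x \<in># A \<Longrightarrow> h x \<in> R) \<Longrightarrow> N (\<Prod>x\<in>#A. h x) = (\<Prod>x\<in>#A. N (h x))"
  and prod_mset_in_R: "(\<And>x. x \<in># A \<Longrightarrow> h x \<in> R) \<Longrightarrow> (\<Prod>x\<in>#A. h x) \<in> R"
proof -
  have "N (\<Prod>x\<in>#A. h x) = (\<Prod>x\<in>#A. N (h x)) \<and> (\<Prod>x\<in>#A. h x) \<in> R" if "\<And>x. x \<in># A \<Longrightarrow> h x \<in> R"
    using that by (induction A) (auto simp: N_one N_mult R_closed)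
  then show "(\<And>x. x \<in># A \<Longrightarrow> h x \<in> R) \<Longrightarrow> N (\<Prod>x\<in>#A. h x) = (\<Prod>x\<in>#A. N (h x))"
    "(\<And>x. x \<in># A \<Longrightarrow> h x \<in> R) \<Longrightarrow> (\<Prod>x\<in>#A. h x) \<in> R" by blast+
qed

lemma N_prod_lessThan: "(\<And>i. h i \<in> R) \<Longrightarrow> N (\<Prod>i<k. h i) = (\<Prod>i<k. N (h i)) \<and> (\<Prod>i<k. h i) \<in> R"
  for k :: nat
  by (induction k) (auto simp: N_one N_mult R_closed)

lemma N_sum_le:
  assumes "\<And>i. i \<in> I \<Longrightarrow> h i \<in> R \<and> N (h i) \<le> b" and "0 \<le> b"
  shows "N (sum h I) \<le> b"
  using assms(1)
proof (induction I rule: infinite_finite_induct)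
  case (insert i I)
  have "N (h i + sum h I) \<le> max (N (h i)) (N (sum h I))"
    using insert by (intro N_add R_closed) auto
  moreover have "N (h i) \<le> b" "N (sum h I) \<le> b" using insert by auto
  ultimately show ?case using insert.hyps by simp
qed (use assms(2) N_zero in auto)

lemma N_of_int_le_1: "N (of_int z) \<le> 1"
  by (intro N_le_1 R_closed)

lemma N_p_power: "N (of_nat p ^ k) = real p powr - real k"
  using p_pos by (simp add: N_power of_nat_in_R N_p powr_minus_divide powr_realpow power_one_over)

lemma N_of_int_le:
  assumes "int p ^ k dvd z"
  shows "N (of_int z) \<le> real p powr - real k"
proof -
  obtain w where w: "z = int p ^ k * w" using assms by (elim dvdE)
  have "N (of_int z) = real p powr - real k * N (of_int w)"
    using N_mult[of "of_nat p ^ k" "of_int w"] by (simp add: w R_closed of_nat_in_R N_p_power)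
  also have "\<dots> \<le> real p powr - real k * 1"
    by (intro mult_left_mono N_of_int_le_1) auto
  finally show ?thesis by simp
qed

text \<open>In a Bezout relation \<open>1 = a * p + b * w\<close> the first summand has absolute
  value below 1, so the second must reach 1.\<close>

lemma N_of_int_unit:
  assumes "\<not> int p dvd w"
  shows "N (of_int w) = 1"
proof -
  have "coprime (int p) w" using p assms by (simp add: prime_imp_coprime)
  then obtain a b where "a * int p + b * w = 1"
    using bezout_int[of "int p" w] by (auto simp: coprime_iff_gcd_eq_1)
  then have eq: "(1 :: complex) = of_int a * of_nat p + of_int b * of_int w"
    by (metis of_int_1 of_int_add of_int_mult of_int_of_nat_eq)
  have "N 1 \<le> max (N (of_int a * of_nat p)) (N (of_int b * of_int w))"
    unfolding eq by (intro N_add R_closed of_nat_in_R)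
  moreover have "N (of_int a * of_nat p) < 1"
  proof -
    have "N (of_int a * of_nat p) \<le> 1 * (1 / real p)"
      unfolding N_mult[OF R_closed(9) of_nat_in_R] N_p by (intro mult_right_mono N_of_int_le_1) auto
    also have "\<dots> < 1" using p_gt_1 by simp
    finally show ?thesis .
  qed
  ultimately have "1 \<le> N (of_int b) * N (of_int w)"
    using N_mult[of "of_int b" "of_int w"] N_one R_closed by simp
  also have "\<dots> \<le> 1 * N (of_int w)"
    by (intro mult_right_mono N_of_int_le_1 N_nonneg R_closed)
  finally show ?thesis using N_of_int_le_1[of w] by simp
qed

lemma N_of_int:
  assumes "z \<noteq> 0"
  shows "N (of_int z) = real p powr - real (multiplicity (int p) z)"
proof -
  have "\<not> is_unit (int p)" using p_gt_1 by simp
  then obtain w where w: "z = int p ^ multiplicity (int p) z * w" "\<not> int p dvd w"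
    using multiplicity_decompose'[OF assms] by blast
  have "N (of_int z) = N (of_nat p ^ multiplicity (int p) z * of_int w)"
    by (subst w(1)) simp
  then show ?thesis
    using N_of_int_unit[OF w(2)] by (simp add: N_mult N_p_power R_closed of_nat_in_R)
qed

definition ieval :: "int poly \<Rightarrow> complex \<Rightarrow> complex" where
  "ieval h x = poly (map_poly of_int h) x"

lemma ieval_in_R: "x \<in> R \<Longrightarrow> ieval h x \<in> R"
  unfolding ieval_def by (auto simp: poly_altdef intro!: R_closed)

lemma ieval_of_int: "ieval h (of_int n) = of_int (poly h n)"
  by (simp add: ieval_def)

lemma ieval_newton:
  "ieval (\<Sum>k\<le>d. smult (c k) (ffact_poly k)) y = (\<Sum>k\<le>d. of_int (c k) * (\<Prod>i<k. y - of_nat i))"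
proof -
  have "ieval (ffact_poly k) y = (\<Prod>i<k. y - of_nat i)" for k
    unfolding ieval_def ffact_poly_def
    by (induction k) (auto simp: of_int_poly_hom.hom_mult hom_distribs algebra_simps)
  then show ?thesis
    unfolding ieval_def by (simp add: of_int_poly_hom.hom_sum of_int_hom.map_poly_hom_smult poly_sum)
qed

lemma N_minus_nat_le:
  assumes "y \<in> R" and "0 \<le> l" and "N y \<le> real p powr - l"
  shows "N (y - of_nat i) \<le> real p powr - mu l (int i)"
proof -
  obtain T where T: "int p ^ T dvd int i" "mu l (int i) = min l (real T)"
    using mu_cases[OF assms(2), of "int i"] by blast
  have "N (y - of_nat i) \<le> max (N y) (N (of_nat i))"
    using assms(1) by (intro N_diff of_nat_in_R)
  moreover have "N (of_nat i) \<le> real p powr - real T" using N_of_int_le[OF T(1)] by simp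
  moreover have "real p powr - l \<le> real p powr - min l (real T)"
    "real p powr - real T \<le> real p powr - min l (real T)"
    using p_gt_1 by (intro powr_mono; simp)+
  ultimately show ?thesis using assms(3) unfolding T(2) by linarith
qed

lemma N_newton_term_le:
  assumes y: "y \<in> R" "0 \<le> l" "N y \<le> real p powr - l"
  shows "N (\<Prod>i<k. y - of_nat i) \<le> real p powr - (real k * phi l)"
proof -
  have R: "y - of_nat i \<in> R" for i using y by (intro R_closed of_nat_in_R)
  have "N (\<Prod>i<k. y - of_nat i) = (\<Prod>i<k. N (y - of_nat i))"
    using N_prod_lessThan[of "\<lambda>i. y - of_nat i"] R by simp
  also have "\<dots> \<le> (\<Prod>i<k. real p powr - mu l (int i))"
    using N_minus_nat_le[OF y] N_nonneg[OF R] by (intro prod_mono) auto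
  also have "\<dots> = real p powr - (\<Sum>i<k. mu l (int i))"
    using p_pos by (subst sum_negf[symmetric]) (simp add: powr_sum)
  also have "\<dots> \<le> real p powr - (real k * phi l)"
    using sum_mu_ge p_gt_1 by (intro powr_mono) auto
  finally show ?thesis .
qed

text \<open>In the Newton expansion of \<open>f\<close> around the integer \<open>c\<close>, the \<open>k\<close>-th coefficient has valuation at
  least \<open>s - k theta\<close>, while the \<open>k\<close>-th falling factorial at \<open>x - c\<close> has valuation at least
  \<open>k phi l\<close>; as \<open>phi l \<le> theta\<close>, the worst case is \<open>k = s / theta\<close>.\<close>

lemma N_ieval_le:
  assumes dvd: "\<And>n. int p ^ s dvd poly f n" and L: "L > 0" "(p - 1) * s + 1 < p ^ Suc L"
    and x: "x \<in> R" "0 \<le> l" "N (x - of_int c) \<le> real p powr - l"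
  shows "N (ieval f x) \<le> real p powr - (real s * phi l / theta)"
proof -
  define h where "h = pcompose f [:c, 1:]"
  define y where "y = x - of_int c"
  have y: "y \<in> R" "N y \<le> real p powr - l" using x by (auto simp: y_def intro: R_closed)
  have hdvd: "int p ^ s dvd poly h n" for n using dvd by (simp add: h_def poly_pcompose)
  have eval: "ieval f x = ieval h y"
    by (simp add: ieval_def h_def y_def of_int_hom.map_poly_pcompose poly_pcompose hom_distribs)
  obtain d a where h: "h = (\<Sum>k\<le>d. smult (a k) (ffact_poly k))"
    using newton_expansion[of h "degree h"] by blast
  have th: "theta > 0" using theta_pos L by simp
  have "N (of_int (a k) * (\<Prod>i<k. y - of_nat i)) \<le> real p powr - (real s * phi l / theta)"
    if "k \<le> d" for k
  proof -
    have R: "y - of_nat i \<in> R" for i using y by (intro R_closed of_nat_in_R)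
    then have R': "(\<Prod>i<k. y - of_nat i) \<in> R" using N_prod_lessThan[of "\<lambda>i. y - of_nat i"] by simp
    have eq: "N (of_int (a k) * (\<Prod>i<k. y - of_nat i)) = N (of_int (a k)) * N (\<Prod>i<k. y - of_nat i)"
      using R' by (intro N_mult R_closed)
    note newton = N_newton_term_le[OF y(1) x(2) y(2), of k]
    show ?thesis
    proof (cases "real k * theta \<ge> real s")
      \<comment> \<open>For large \<open>k\<close> the falling factorial alone is small enough, and
        integrality of \<open>a k\<close> suffices.\<close>
      case True
      have le: "real s * phi l / theta \<le> real k * phi l"
        using mult_right_mono[OF True phi_nonneg[of l]] th by (simp add: field_simps)
      have "N (of_int (a k)) * N (\<Prod>i<k. y - of_nat i) \<le> 1 * real p powr - (real k * phi l)"
        using newton R' by (intro mult_mono N_of_int_le_1 N_nonneg) auto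
      also have "1 * real p powr - (real k * phi l) \<le> real p powr - (real s * phi l / theta)"
        using p_gt_1 le by simp
      finally show ?thesis unfolding eq .
    next
      case False
      have le: "real s * phi l / theta \<le> real s - real k * theta + real k * phi l"
      proof -
        have "0 \<le> (real s - real k * theta) * (theta - phi l)"
          using False phi_le_theta by (intro mult_nonneg_nonneg) auto
        then show ?thesis using th by (simp add: field_simps)
      qed
      \<comment> \<open>The choice of \<open>L\<close> enters here: \<open>k\<close> is small enough
        for \<open>fact k\<close> to have valuation at most \<open>k * theta\<close>.\<close>
      have "k < p ^ Suc L"
      proof (rule ccontr)
        assume "\<not> k < p ^ Suc L"
        then have "real p ^ Suc L \<le> real k" by (metis not_less of_nat_le_iff of_nat_power)
        then have "real p ^ Suc L * theta \<le> real k * theta" using th by (intro mult_right_mono) auto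
        then show False using False le_power_mult_theta[OF L(2)] by simp
      qed
      have "real p powr - (real k * theta) \<le> N (of_int (fact k))"
        using multiplicity_fact_le[OF \<open>k < p ^ Suc L\<close>] N_of_int[of "fact k"] p_gt_1 by simp
      then have "N (of_int (a k)) * real p powr - (real k * theta) \<le> N (of_int (a k)) * N (of_int (fact k))"
        by (intro mult_left_mono N_nonneg R_closed)
      also have "\<dots> = N (of_int (a k * fact k))" by (simp only: N_mult R_closed of_int_mult)
      also have "\<dots> \<le> real p powr - real s"
        using dvd_newton_coeff_mult_fact[OF h hdvd that] by (intro N_of_int_le)
      finally have coeff: "N (of_int (a k)) \<le> real p powr - (real s - real k * theta)"
        using p_pos by (simp add: powr_minus powr_diff field_simps)
      have "N (of_int (a k)) * N (\<Prod>i<k. y - of_nat i)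
          \<le> real p powr - (real s - real k * theta) * real p powr - (real k * phi l)"
        using coeff newton R' by (intro mult_mono N_nonneg) auto
      also have "\<dots> = real p powr - (real s - real k * theta + real k * phi l)"
        using p_pos by (simp flip: powr_add)
      also have "real p powr - (real s - real k * theta + real k * phi l) \<le> real p powr - (real s * phi l / theta)"
        using p_gt_1 le by simp
      finally show ?thesis unfolding eq .
    qed
  qed
  moreover have "of_int (a k) * (\<Prod>i<k. y - of_nat i) \<in> R" for k
    using N_prod_lessThan[of "\<lambda>i. y - of_nat i"] y by (intro R_closed) (auto intro: R_closed of_nat_in_R)
  ultimately show ?thesis
    unfolding eval h ieval_newton by (intro N_sum_le) auto
qed

subsection \<open>The valuation of the resultant\<close>

text \<open>The minimum of \<open>L\<close> and the valuation of \<open>z\<close>; the truncation keeps it finite at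
  \<open>N z = 0\<close>.\<close>

definition trunc_val :: "complex \<Rightarrow> real" where
  "trunc_val z = - log (real p) (max (real p powr - real L) (N z))"

lemma powr_trunc_val: "real p powr - trunc_val z = max (real p powr - real L) (N z)"
  using p_gt_1 by (simp add: trunc_val_def less_max_iff_disj)

lemma trunc_val_le_L: "trunc_val z \<le> real L"
  and trunc_val_nonneg: "z \<in> R \<Longrightarrow> 0 \<le> trunc_val z"
proof -
  have "real p powr - real L \<le> real p powr - trunc_val z" by (simp add: powr_trunc_val)
  then show "trunc_val z \<le> real L" using p_gt_1 by simp
next
  assume "z \<in> R"
  then have "real p powr - trunc_val z \<le> real p powr 0"
    using N_le_1 p_gt_1 powr_mono[of "- real L" 0 "real p"] by (simp add: powr_trunc_val)
  then show "0 \<le> trunc_val z" using p_gt_1 by (subst (asm) powr_le_cancel_iff) auto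
qed

text \<open>Since \<open>c0\<close> is at least as close to \<open>x\<close> as \<open>c\<close> is,
  the ultrametric inequality makes \<open>c - c0\<close> no larger than \<open>x - c\<close>, up to
  truncation.\<close>

lemma trunc_val_le_mu:
  assumes x: "x \<in> R" and le: "trunc_val (x - of_int c) \<le> trunc_val (x - of_int c0)"
  shows "trunc_val (x - of_int c) \<le> mu (trunc_val (x - of_int c0)) (c - c0)"
proof -
  have in_R: "x - of_int c \<in> R" "x - of_int c0 \<in> R" using x by (auto intro: R_closed)
  obtain T where T: "T \<le> L" "T = L \<or> \<not> int p ^ Suc T dvd c - c0"
    and mu: "mu (trunc_val (x - of_int c0)) (c - c0) = min (trunc_val (x - of_int c0)) (real T)"
    using mu_cases[OF trunc_val_nonneg[OF in_R(2)], of "c - c0"] by metis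
  have "trunc_val (x - of_int c) \<le> real T"
  proof (cases "T = L")
    case True
    then show ?thesis using trunc_val_le_L by simp
  next
    case False
    then have ndvd: "\<not> int p ^ Suc T dvd c - c0" using T by simp
    then have nz: "c - c0 \<noteq> 0" by auto
    have "multiplicity (int p) (c - c0) < Suc T"
      using ndvd multiplicity_dvd'[of "Suc T" "int p" "c - c0"] by (meson not_less)
    then have "real p powr - real T \<le> N (of_int (c - c0))"
      using N_of_int[OF nz] p_gt_1 by simp
    also have "of_int (c - c0) = (x - of_int c0) - (x - of_int c)" by simp
    also have "N \<dots> \<le> max (N (x - of_int c0)) (N (x - of_int c))" using in_R by (intro N_diff)
    also have "\<dots> \<le> max (real p powr - trunc_val (x - of_int c0)) (real p powr - trunc_val (x - of_int c))"
      unfolding powr_trunc_val by auto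
    also have "\<dots> = real p powr - trunc_val (x - of_int c)"
      using le p_gt_1 by simp
    finally show ?thesis using p_gt_1 by simp
  qed
  then show ?thesis unfolding mu using le by simp
qed

text \<open>With \<open>c0\<close> a residue nearest to \<open>x\<close>, the distances from
  \<open>x\<close> to all residues are controlled by those from \<open>c0\<close>, whose sum is
  known.\<close>

lemma sum_trunc_val_le:
  assumes x: "x \<in> R"
  obtains c0 :: int where "(\<Sum>c<p ^ L. trunc_val (x - of_nat c)) \<le> real p ^ L * phi (trunc_val (x - of_int c0))"
proof -
  have "{..<p ^ L} \<noteq> {}" using p_pos by (auto simp: lessThan_empty_iff)
  \<comment> \<open>Minimising the negated truncated valuation picks a nearest residue
    \<open>b\<close>.\<close>
  from arg_min_if_finite(2)[OF finite_lessThan this, of "\<lambda>c. - trunc_val (x - of_nat c)"]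
  obtain b where max: "trunc_val (x - of_nat c) \<le> trunc_val (x - of_nat b)" if "c < p ^ L" for c
    using not_le by auto
  have "(\<Sum>c<p ^ L. trunc_val (x - of_nat c)) \<le> (\<Sum>c<p ^ L. mu (trunc_val (x - of_nat b)) (int c - int b))"
    using trunc_val_le_mu[OF x, of "int _" "int b"] max by (intro sum_mono) auto
  also have "\<dots> \<le> real p ^ L * phi (trunc_val (x - of_nat b))" by (rule sum_mu_residues_le)
  finally show thesis using that[of "int b"] by simp
qed

text \<open>The point \<open>x\<close> is generic in the disc of radius \<open>p\<^bsup>-L\<^esup>\<close> around \<open>c\<close>: evaluating at \<open>x\<close>
  computes the Gauss norm of the disc. It is a root of \<open>(\<Prod>b\<in>#J. X - b) + p ^ (L * size J)\<close>.\<close>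

lemma ex_generic_point:
  assumes J: "\<And>b. b \<in># J \<Longrightarrow> b \<in> R \<and> N (b - of_int c) \<le> real p powr - real L"
  obtains x where "x \<in> R" and "N (x - of_int c) \<le> real p powr - real L"
    and "(\<Prod>b\<in>#J. N (x - b)) = (real p powr - real L) ^ size J"
proof (cases "J = {#}")
  \<comment> \<open>Without roots the auxiliary polynomial would be constant; the centre itself
    serves.\<close>
  case True
  then show thesis using that[of "of_int c"] R_closed N_zero by simp
next
  case False
  define H where "H = (\<Prod>b\<in>#J. [:- b, 1:])"
  define h where "h = H + [:of_nat p ^ (L * size J):]"
  have deg: "degree H = size J" unfolding H_def by (rule degree_prod_mset_linear)
  have pos: "size J > 0" using False by (simp add: nonempty_has_size)
  have degh: "degree h = size J" unfolding h_def using deg pos by (subst degree_add_eq_left) auto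
  have "coeff h (size J) = lead_coeff H"
    using pos by (simp add: h_def deg coeff_eq_0)
  then have "lead_coeff h = 1"
    unfolding degh H_def by (simp only: lead_coeff_prod_mset_linear)
  moreover have "coeff h i \<in> R" for i
    unfolding h_def H_def coeff_add using J
    by (intro R_closed subring_coeff_prod_mset_linear subring)
      (auto simp: coeff_pCons intro: R_closed of_nat_in_R split: nat.split)
  moreover obtain x where x: "poly h x = 0"
    using alg_closed_imp_poly_has_root[of h] degh pos by auto
  ultimately have xR: "x \<in> R" using integrally_closed by blast
  have in_R: "x - b \<in> R" if "b \<in># J" for b using J that xR by (intro R_closed) auto
  have "(\<Prod>b\<in>#J. x - b) = - (of_nat p ^ (L * size J))"
    using x poly_prod_mset_linear[of J x] unfolding h_def H_def by (simp add: eq_neg_iff_add_eq_0)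
  then have "N (\<Prod>b\<in>#J. x - b) = real p powr - real (L * size J)"
    using N_uminus[of "of_nat p ^ (L * size J)"] R_closed of_nat_in_R N_p_power by simp
  then have prod: "(\<Prod>b\<in>#J. N (x - b)) = (real p powr - real L) ^ size J"
    using N_prod_mset[of J "\<lambda>b. x - b"] in_R p_pos
    by (simp add: powr_power mult.commute)
  \<comment> \<open>Outside the disc, \<open>x\<close> would be at least as far from each
    \<open>b\<close> as from \<open>c\<close>, making the product too large.\<close>
  have "N (x - of_int c) \<le> real p powr - real L"
  proof (rule ccontr)
    assume far: "\<not> ?thesis"
    have "N (x - of_int c) \<le> N (x - b)" if "b \<in># J" for b
    proof -
      have "N ((x - b) + (b - of_int c)) \<le> max (N (x - b)) (N (b - of_int c))"
        using J[OF that] in_R[OF that] R_closed(6,9) by (intro N_add) auto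
      moreover have "(x - b) + (b - of_int c) = x - of_int c" by simp
      ultimately show ?thesis using J[OF that] far by (simp add: le_max_iff_disj)
    qed
    then have "(\<Prod>b\<in>#J. N (x - of_int c)) \<le> (\<Prod>b\<in>#J. N (x - b))"
      using xR by (intro prod_mset_mono_nonneg) (auto intro: N_nonneg R_closed)
    then have "N (x - of_int c) ^ size J \<le> (real p powr - real L) ^ size J"
      unfolding prod by simp
    then show False using far pos power_less_imp_less_base
      by (metis linorder_not_le power_strict_mono powr_ge_zero)
  qed
  with xR prod show thesis using that by blast
qed

text \<open>Take \<open>x\<close> generic in the disc for the roots \<open>J\<close> inside it. The
  distances from \<open>x\<close> to \<open>J\<close> multiply to what truncation gives, and the
  roots \<open>K\<close> outside are no closer to \<open>x\<close> than to \<open>c\<close>; so the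
  truncated product is at most \<open>N (ieval g x)\<close>.\<close>

lemma sum_trunc_val_roots_ge:
  assumes dvd: "\<And>n. int p ^ s dvd poly g n" and L: "L > 0" "(p - 1) * s + 1 < p ^ Suc L"
    and B: "set_mset B \<subseteq> R" and gB: "map_poly of_int g = (\<Prod>b\<in>#B. [:- b, 1:])"
  shows "real s \<le> (\<Sum>b\<in>#B. trunc_val (b - of_int c))"
proof -
  define J where "J = filter_mset (\<lambda>b. N (b - of_int c) \<le> real p powr - real L) B"
  define K where "K = filter_mset (\<lambda>b. \<not> N (b - of_int c) \<le> real p powr - real L) B"
  have BJK: "B = J + K" unfolding J_def K_def by (rule multiset_partition)
  obtain x where x: "x \<in> R" "N (x - of_int c) \<le> real p powr - real L"
    and prodJ: "(\<Prod>b\<in>#J. N (x - b)) = (real p powr - real L) ^ size J"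
    using ex_generic_point[of J c] B unfolding J_def by auto
  have "real p powr - (\<Sum>b\<in>#B. trunc_val (b - of_int c)) = (\<Prod>b\<in>#B. max (real p powr - real L) (N (b - of_int c)))"
    using p_pos by (simp add: powr_minus_sum_mset powr_trunc_val)
  also have "\<dots> = (\<Prod>b\<in>#J. max (real p powr - real L) (N (b - of_int c))) *
      (\<Prod>b\<in>#K. max (real p powr - real L) (N (b - of_int c)))"
    unfolding BJK by simp
  also have "(\<Prod>b\<in>#J. max (real p powr - real L) (N (b - of_int c))) = (\<Prod>b\<in>#J. real p powr - real L)"
    by (intro arg_cong[of _ _ prod_mset] image_mset_cong) (auto simp: J_def)
  also have "\<dots> = (\<Prod>b\<in>#J. N (x - b))" unfolding prodJ by simp
  also have "(\<Prod>b\<in>#J. N (x - b)) * (\<Prod>b\<in>#K. max (real p powr - real L) (N (b - of_int c)))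
      \<le> (\<Prod>b\<in>#J. N (x - b)) * (\<Prod>b\<in>#K. N (x - b))"
  proof (intro mult_left_mono prod_mset_mono_nonneg)
    fix b assume b: "b \<in># K"
    then have bR: "b \<in> R" and far: "N (b - of_int c) > real p powr - real L" using B by (auto simp: K_def)
    have "N ((x - of_int c) - (x - b)) \<le> max (N (x - of_int c)) (N (x - b))"
      using x bR by (intro N_diff R_closed)
    moreover have "(x - of_int c) - (x - b) = b - of_int c" by simp
    ultimately have "N (b - of_int c) \<le> N (x - b)" using x(2) far by simp
    then show "0 \<le> max (real p powr - real L) (N (b - of_int c)) \<and>
        max (real p powr - real L) (N (b - of_int c)) \<le> N (x - b)"
      using far powr_ge_zero[of "real p" "- real L"] by linarith
  qed (simp add: prodJ)
  also have "\<dots> = (\<Prod>b\<in>#B. N (x - b))" unfolding BJK by simp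
  also have "\<dots> = N (ieval g x)"
    unfolding ieval_def gB poly_prod_mset_linear using B x
    by (subst N_prod_mset) (auto intro: R_closed)
  also have "\<dots> \<le> real p powr - (real s * phi (real L) / theta)"
    by (rule N_ieval_le[OF dvd L x(1) _ x(2)]) simp
  \<comment> \<open>At radius \<open>p\<close> to the \<open>-L\<close> the Newton estimate yields
    the full \<open>s\<close>.\<close>
  also have "real s * phi (real L) / theta = real s" using theta_pos[OF L(1)] by (simp add: phi_L)
  finally show ?thesis using p_gt_1 by simp
qed

lemma prod_N_ieval_roots_le:
  assumes f: "\<And>n. int p ^ s dvd poly f n" and g: "\<And>n. int p ^ s dvd poly g n"
    and L: "L > 0" "(p - 1) * s + 1 < p ^ Suc L"
    and B: "set_mset B \<subseteq> R" and gB: "map_poly of_int g = (\<Prod>b\<in>#B. [:- b, 1:])"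
    and b0: "b0 \<in># B" "N (ieval f b0) \<le> real p powr - real S"
  shows "(\<Prod>b\<in>#B. N (ieval f b)) \<le> real p powr - (real S - real s + real s ^ 2 / theta)"
proof -
  have th: "theta > 0" using theta_pos L by simp
  define W where "W b = real s / theta * ((\<Sum>c<p ^ L. trunc_val (b - of_nat c)) / real p ^ L)" for b
  have W: "N (ieval f b) \<le> real p powr - W b" "W b \<le> real s" if "b \<in># B" for b
  proof -
    have bR: "b \<in> R" using B that by auto
    obtain c0 where c0: "(\<Sum>c<p ^ L. trunc_val (b - of_nat c)) \<le> real p ^ L * phi (trunc_val (b - of_int c0))"
      using sum_trunc_val_le[OF bR] by blast
    define l where "l = trunc_val (b - of_int c0)"
    have "N (b - of_int c0) \<le> real p powr - l" unfolding l_def powr_trunc_val by simp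
    moreover have "0 \<le> l" unfolding l_def using bR by (intro trunc_val_nonneg R_closed)
    ultimately have "N (ieval f b) \<le> real p powr - (real s * phi l / theta)"
      using N_ieval_le[OF f L bR] by blast
    moreover have Wl: "W b \<le> real s / theta * phi l"
      unfolding W_def using c0 th p_pos
      by (intro mult_left_mono) (auto simp: l_def field_simps)
    then have "real p powr - (real s * phi l / theta) \<le> real p powr - W b" using p_gt_1 by simp
    ultimately show "N (ieval f b) \<le> real p powr - W b" by linarith
    have "real s / theta * phi l \<le> real s / theta * theta"
      using th phi_le_theta by (intro mult_left_mono) auto
    with Wl show "W b \<le> real s" using th by simp
  qed
  \<comment> \<open>Each residue contributes at least \<open>s\<close>; exchanging the sums turns
    the average over residues into the sum of \<open>W\<close> over the roots.\<close>
  have "real s / theta * real s = real s / theta * ((\<Sum>c<p ^ L. real s) / real p ^ L)"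
    using p_pos by simp
  also have "\<dots> \<le> real s / theta * ((\<Sum>c<p ^ L. \<Sum>b\<in>#B. trunc_val (b - of_nat c)) / real p ^ L)"
    using sum_trunc_val_roots_ge[OF g L B gB, of "int _"] th
    by (intro mult_left_mono divide_right_mono sum_mono) auto
  also have "\<dots> = (\<Sum>b\<in>#B. W b)"
  proof -
    have "(\<Sum>b\<in>#B. W b) = (\<Sum>b\<in>#B. real s / theta / real p ^ L * (\<Sum>c<p ^ L. trunc_val (b - of_nat c)))"
      by (simp add: W_def)
    also have "\<dots> = real s / theta / real p ^ L * (\<Sum>b\<in>#B. \<Sum>c<p ^ L. trunc_val (b - of_nat c))"
      by (rule sum_mset_distrib_left[symmetric])
    finally show ?thesis by (simp add: sum_mset_sum_swap)
  qed
  finally have sumW: "real s ^ 2 / theta \<le> (\<Sum>b\<in>#B. W b)" by (simp add: power2_eq_square)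
  obtain B' where B': "B = add_mset b0 B'" using b0(1) by (metis insert_DiffM)
  have nonneg: "0 \<le> N (ieval f b)" if "b \<in># B" for b
    using that B by (auto intro: N_nonneg ieval_in_R)
  \<comment> \<open>Replacing \<open>W b0\<close> by \<open>S\<close> gains at least
    \<open>S - s\<close>, because \<open>W b0\<close> is at most \<open>s\<close>.\<close>
  have le: "real S - real s + real s ^ 2 / theta \<le> real S + (\<Sum>b\<in>#B'. W b)"
    using sumW W(2)[OF b0(1)] by (simp add: B')
  have "(\<Prod>b\<in>#B. N (ieval f b)) = N (ieval f b0) * (\<Prod>b\<in>#B'. N (ieval f b))" by (simp add: B')
  also have "\<dots> \<le> real p powr - real S * (\<Prod>b\<in>#B'. real p powr - W b)"
    using W(1) nonneg b0(2)
    by (intro mult_mono prod_mset_mono_nonneg prod_mset_nonneg) (auto simp: B')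
  also have "\<dots> = real p powr - (real S + (\<Sum>b\<in>#B'. W b))"
    using p_pos by (simp add: powr_minus_sum_mset[symmetric] flip: powr_add)
  also have "real p powr - (real S + (\<Sum>b\<in>#B'. W b)) \<le> real p powr - (real S - real s + real s ^ 2 / theta)"
    using p_gt_1 le by simp
  finally show ?thesis .
qed

lemma resultant_valuation_ge:
  assumes f: "\<And>n. int p ^ s dvd poly f n" and g: "\<And>n. int p ^ s dvd poly g n"
    and monic: "lead_coeff f = 1" "lead_coeff g = 1" and res: "resultant f g \<noteq> 0"
    and s: "s > 0" and L: "L > 0" "(p - 1) * s + 1 < p ^ Suc L"
    and S: "int p ^ S dvd poly f n" "int p ^ S dvd poly g n"
  shows "real S - real s + real s ^ 2 / theta \<le> real (multiplicity (int p) (resultant f g))"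
proof -
  define F G where "F = (map_poly of_int f :: complex poly)" and "G = (map_poly of_int g :: complex poly)"
  have lc: "lead_coeff F = 1" "lead_coeff G = 1" using monic by (auto simp: F_def G_def)
  then have "F \<noteq> 0" "G \<noteq> 0" by auto
  then obtain A B where A: "F = (\<Prod>a\<in>#A. [:- a, 1:])" and B: "G = (\<Prod>b\<in>#B. [:- b, 1:])"
    using alg_closed_imp_factorization[of F] alg_closed_imp_factorization[of G] lc by auto
  have roots_in_R: "set_mset A \<subseteq> R" if "map_poly of_int h = (\<Prod>a\<in>#A. [:- a, 1:])" "lead_coeff h = 1" for h A
  proof
    fix a assume "a \<in># A"
    then have "poly (map_poly of_int h) a = 0"
      unfolding that(1) poly_prod_mset_linear by (auto simp: prod_mset_zero_iff)
    moreover have "lead_coeff (map_poly of_int h :: complex poly) = 1" using that(2) by simp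
    moreover have "coeff (map_poly of_int h) i \<in> R" for i by (simp add: R_closed)
    ultimately show "a \<in> R" using integrally_closed by blast
  qed
  have AR: "set_mset A \<subseteq> R" using roots_in_R[of f A] A monic by (simp add: F_def)
  have BR: "set_mset B \<subseteq> R" using roots_in_R[of g B] B monic by (simp add: G_def)
  have N_res: "N (of_int (resultant h k)) = (\<Prod>b\<in>#B. N (ieval h b))"
    if "h \<noteq> 0" "k \<noteq> 0" "lead_coeff k = 1" "map_poly of_int k = (\<Prod>b\<in>#B. [:- b, 1:])" "set_mset B \<subseteq> R" for h k B
  proof -
    have "of_int (resultant h k) = resultant (map_poly of_int h) (map_poly of_int k :: complex poly)"
      by (rule of_int_hom.resultant_hom[symmetric])
    also have "\<dots> = (- 1) ^ (degree h * degree k) * (\<Prod>b\<in>#B. ieval h b)"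
    proof -
      define K where "K = (map_poly of_int k :: complex poly)"
      have K: "K \<noteq> 0" "lead_coeff K = 1" "degree K = degree k" using that(2,3) by (auto simp: K_def)
      have "K = (\<Prod>b\<in>#B. [:- b, 1:])" unfolding K_def by (rule that(4))
      then have "K = smult (lead_coeff K) (\<Prod>b\<in>#B. [:- b, 1:])"
        unfolding K(2) smult_1_left .
      from resultant_eq_prod_roots[OF _ K(1) this, of "map_poly of_int h"] show ?thesis
        using that(1) K(2,3) by (simp add: ieval_def flip: K_def)
    qed
    also have "N \<dots> = (\<Prod>b\<in>#B. N (ieval h b))"
      using that(5) by (subst N_mult) (auto simp: N_power N_uminus N_one N_prod_mset R_closed ieval_in_R subset_iff intro!: prod_mset_in_R R_closed ieval_in_R)
    finally show ?thesis .
  qed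
  \<comment> \<open>If no root \<open>a\<close> is nearer to \<open>n\<close> than \<open>b\<close>,
    the ultrametric inequality shows that \<open>b\<close> is at least as close to each
    \<open>a\<close> as \<open>n\<close> is.\<close>
  have closer: "N (ieval h b) \<le> real p powr - real S"
    if "map_poly of_int h = (\<Prod>a\<in>#A. [:- a, 1:])" "set_mset A \<subseteq> R" "b \<in> R"
      "\<And>a. a \<in># A \<Longrightarrow> N (of_int n - b) \<le> N (of_int n - a)" "int p ^ S dvd poly h n" for h A b
  proof -
    have ev: "N (ieval h x) = (\<Prod>a\<in>#A. N (x - a))" if "x \<in> R" for x
      unfolding ieval_def \<open>map_poly of_int h = _\<close> poly_prod_mset_linear using \<open>set_mset A \<subseteq> R\<close> that
      by (subst N_prod_mset) (auto intro: R_closed)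
    have "N (b - a) \<le> N (of_int n - a)" if "a \<in># A" for a
    proof -
      have aR: "a \<in> R" using that \<open>set_mset A \<subseteq> R\<close> by auto
      have "N ((of_int n - a) - (of_int n - b)) \<le> max (N (of_int n - a)) (N (of_int n - b))"
        using aR \<open>b \<in> R\<close> by (intro N_diff R_closed)
      moreover have "(of_int n - a) - (of_int n - b) = b - a" by simp
      ultimately show ?thesis using \<open>\<And>a. a \<in># A \<Longrightarrow> N (of_int n - b) \<le> N (of_int n - a)\<close>[OF that] by simp
    qed
    then have "N (ieval h b) \<le> N (ieval h (of_int n))"
      unfolding ev[OF \<open>b \<in> R\<close>] ev[OF R_closed(9)] using \<open>set_mset A \<subseteq> R\<close> \<open>b \<in> R\<close>
      by (intro prod_mset_mono_nonneg) (auto intro!: N_nonneg R_closed)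
    also have "\<dots> \<le> real p powr - real S"
      unfolding ieval_of_int by (rule N_of_int_le[OF \<open>int p ^ S dvd poly h n\<close>])
    finally show ?thesis .
  qed
  \<comment> \<open>A nearest root must exist; \<open>g = 1\<close> would give
    \<open>p ^ s dvd 1\<close>.\<close>
  have "B \<noteq> {#}"
  proof
    assume "B = {#}"
    then have "of_int (poly g 0) = (1 :: complex)"
      using ieval_of_int[of g 0] B unfolding ieval_def G_def by simp
    then have "poly g 0 = 1" by (simp only: of_int_eq_1_iff)
    then have "int p ^ s dvd 1" using g[of 0] by simp
    then show False using s p_gt_1 one_less_power[of "int p" s] by simp
  qed
  then have "finite (set_mset (A + B))" "set_mset (A + B) \<noteq> {}" by auto
  from arg_min_if_finite[OF this, of "\<lambda>z. N (of_int n - z)"] obtain b where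
    b: "b \<in># A + B" "\<And>a. a \<in># A + B \<Longrightarrow> N (of_int n - b) \<le> N (of_int n - a)"
    by (metis linorder_not_less)
  have f0: "f \<noteq> 0" "g \<noteq> 0" using monic by auto
  have "N (of_int (resultant f g)) \<le> real p powr - (real S - real s + real s ^ 2 / theta)"
  proof (cases "b \<in># B")
    case True
    have "N (ieval f b) \<le> real p powr - real S"
      using closer[of f A b] A AR BR True b S unfolding F_def by auto
    then show ?thesis
      using prod_N_ieval_roots_le[OF f g L BR _ True] N_res[OF f0 monic(2) _ BR] B unfolding G_def by simp
  next
    \<comment> \<open>The nearest root belongs to \<open>f\<close>: exchange the roles, which alters
      the resultant by a sign only.\<close>
    case False
    then have bA: "b \<in># A" using b by auto
    have "N (ieval g b) \<le> real p powr - real S"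
      using closer[of g B b] B AR BR bA b S unfolding G_def by auto
    then have "N (of_int (resultant g f)) \<le> real p powr - (real S - real s + real s ^ 2 / theta)"
      using prod_N_ieval_roots_le[OF g f L AR _ bA] N_res[OF f0(2,1) monic(1) _ AR] A unfolding F_def by simp
    moreover have "N (of_int (resultant f g)) = N (of_int (resultant g f))"
      by (subst resultant_swap, simp, subst N_mult) (auto simp: N_power N_uminus N_one R_closed)
    ultimately show ?thesis by simp
  qed
  then show ?thesis using N_of_int[OF res] p_gt_1 by simp
qed

end

text \<open>A maximal subring of the complex numbers that contains \<open>\<int>\<close> and avoids
  \<open>1 / p\<close> is a valuation ring; taking \<open>P = p\<close> normalises its absolute
  value at \<open>p\<close>.\<close>

lemma ex_padic_absval:
  assumes p: "prime p"
  obtains R N where "padic_absval p R N"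
proof -
  have "1 / of_nat p \<notin> (\<int> :: complex set)"
  proof
    assume "1 / of_nat p \<in> (\<int> :: complex set)"
    then obtain z where "1 / of_nat p = (of_int z :: complex)" by (elim Ints_cases)
    then have "of_int (z * int p) = (of_int 1 :: complex)"
      using prime_gt_0_nat[OF p] by (simp add: field_simps)
    then have "z * int p = 1" by (simp only: of_int_eq_iff)
    then show False using prime_gt_1_nat[OF p] by (simp add: zmult_eq_1_iff)
  qed
  then obtain R where R: "subring R" "\<int> \<subseteq> R" "1 / of_nat p \<notin> (R :: complex set)"
    and max: "\<And>T. subring T \<Longrightarrow> R \<subseteq> T \<Longrightarrow> 1 / of_nat p \<notin> T \<Longrightarrow> T = R"
    using ex_maximal_subring_avoiding[OF subring_Ints] by metis
  have pR: "of_nat p \<in> R" using R(2) by auto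
  interpret M: maximal_avoiding_subring R "of_nat p"
    using R pR max prime_gt_0_nat[OF p] by unfold_locales auto
  interpret valuation_subring R "of_nat p" "real p"
    using M.valuation_ring R pR prime_gt_1_nat[OF p] by unfold_locales auto
  have "padic_absval p R absval"
    using p R(1) absval_nonneg absval_le_1 absval_mult absval_add absval_q integrally_closed
    by unfold_locales auto
  then show thesis using that by blast
qed

section \<open>From divisibility to the supremum in the statement\<close>

lemma enat_le_vp_iff:
  assumes "prime p"
  shows "enat t \<le> vp p x \<longleftrightarrow> int p ^ t dvd x"
proof (cases "x = 0")
  case False
  then have "int p ^ t dvd x \<longleftrightarrow> t \<le> multiplicity (int p) x"
    using prime_gt_1_nat[OF assms] by (intro power_dvd_iff_le_multiplicity) auto
  then show ?thesis using False by (simp add: vp_def)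
qed (simp add: vp_def)

text \<open>The bound makes the supremum finite, so \<open>the_enat\<close> returns its true value,
  and a finite supremum of naturals is attained.\<close>

lemma SUP_enat_attained:
  fixes V :: "int \<Rightarrow> enat"
  assumes bound: "\<And>n. V n \<le> enat K"
  obtains n where "enat (the_enat (SUP n. V n)) \<le> V n"
proof -
  have "(SUP n. V n) \<le> enat K" using bound by (intro SUP_least)
  then obtain S where S: "(SUP n. V n) = enat S" by (cases "SUP n. V n") auto
  have "\<exists>n. enat S \<le> V n"
  proof (rule ccontr)
    assume "\<not> ?thesis"
    then have less: "V n < enat S" for n by (simp add: not_le)
    then obtain T where T: "S = Suc T" by (cases S) (auto simp: zero_enat_def[symmetric])
    have "V n \<le> enat T" for n using less[of n] T by (cases "V n") auto
    then have "(SUP n. V n) \<le> enat T" by (intro SUP_least)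
    then show False using S T by simp
  qed
  then show thesis using that S by auto
qed

theorem theorem1:
  fixes p s :: nat and f g :: "int poly"
  assumes "prime p" and "s > 0"
    and "lead_coeff f = 1" and "lead_coeff g = 1"
    and "resultant f g \<noteq> 0"
    and "\<forall>n::int. min (vp p (poly f n)) (vp p (poly g n)) \<ge> enat s"
  shows "(let S = the_enat (SUP n::int. min (vp p (poly f n)) (vp p (poly g n)))
     in real (multiplicity (int p) (resultant f g))
        \<ge> real S - real s + real p * real s ^ 2 * (real p - 1) /
           (real p - real p powr (1 - real_of_int \<lfloor>log (real p) ((real p - 1) * real s + 1)\<rfloor>)))"
proof -
  obtain R N where "padic_absval p R N" using ex_padic_absval[OF assms(1)] .
  define u where "u = (real p - 1) * real s + 1"
  define L where "L = nat \<lfloor>log (real p) u\<rfloor>"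
  interpret padic_absval p L R N by fact
  have p1: "real p > 1" using p_gt_1 by simp
  \<comment> \<open>As \<open>s \<ge> 1\<close>, the logarithm is at least 1; so \<open>nat\<close>
    loses nothing and \<open>theta\<close> is positive.\<close>
  have "(real p - 1) * 1 \<le> (real p - 1) * real s"
    using \<open>s > 0\<close> p1 by (intro mult_left_mono) auto
  then have "u \<ge> real p" by (simp add: u_def)
  then have "log (real p) u \<ge> 1" using p1 by (simp add: le_log_iff)
  then have fl: "\<lfloor>log (real p) u\<rfloor> = int L" "L > 0" by (auto simp: L_def le_floor_iff)
  then have "log (real p) u < real (Suc L)"
    using floor_correct[of "log (real p) u"] by simp
  then have "u < real p powr real (Suc L)"
    using \<open>u \<ge> real p\<close> p1 by (subst (asm) log_less_iff) auto
  also have "\<dots> = real p ^ Suc L" using p1 by (intro powr_realpow) simp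
  finally have "u < real p ^ Suc L" .
  moreover have "u = real ((p - 1) * s + 1)" using p_gt_1 by (simp add: u_def of_nat_diff)
  ultimately have L: "(p - 1) * s + 1 < p ^ Suc L" by (metis of_nat_less_iff of_nat_power)
  \<comment> \<open>The denominator is \<open>p * (p - 1) * theta\<close>, by summing the geometric
    series.\<close>
  have bound: "real p * real s ^ 2 * (real p - 1) / (real p - real p powr (1 - real_of_int \<lfloor>log (real p) u\<rfloor>))
      = real s ^ 2 / theta"
  proof -
    have "real p - real p powr (1 - real L) = real p * (1 - 1 / real p ^ L)"
      using p1 by (simp add: powr_diff powr_realpow field_simps)
    also have "\<dots> = (real p * (real p - 1)) * theta"
      by (simp only: theta_closed_form[symmetric] mult.assoc mult.commute[of theta])
    finally show ?thesis
      using p1 theta_pos[OF fl(2)] unfolding fl(1) by (simp add: mult.commute mult.left_commute)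
  qed
  define V where "V n = min (vp p (poly f n)) (vp p (poly g n))" for n
  have V: "enat t \<le> V n \<longleftrightarrow> int p ^ t dvd poly f n \<and> int p ^ t dvd poly g n" for t n
    unfolding V_def by (simp add: enat_le_vp_iff[OF assms(1)])
  have s_dvd: "int p ^ s dvd poly f n" "int p ^ s dvd poly g n" for n
    using assms(6) V[of s n] by (auto simp: V_def)
  define M where "M = multiplicity (int p) (resultant f g)"
  \<comment> \<open>Stated for every \<open>t\<close> reached by \<open>V\<close>, since it also
    serves to show that \<open>V\<close> is bounded.\<close>
  have main: "real t - real s + real s ^ 2 / theta \<le> real M" if "enat t \<le> V n" for t n
    using resultant_valuation_ge[OF s_dvd assms(3-5,2) fl(2) L, of t n] that V unfolding M_def by blast
  have "V n \<le> enat (M + s)" for n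
  proof (rule ccontr)
    assume "\<not> V n \<le> enat (M + s)"
    \<comment> \<open>For \<open>t = M + s + 1\<close> the inequality \<open>main\<close> would read
      \<open>M + 1 + s ^ 2 / theta \<le> M\<close>.\<close>
    then have "enat (Suc (M + s)) \<le> V n" by (metis eSuc_enat ileI1 not_le)
    from main[OF this] theta_pos[OF fl(2)] show False
      by (smt (verit) divide_nonneg_pos of_nat_Suc of_nat_add zero_le_power2)
  qed
  then obtain n where "enat (the_enat (SUP n. V n)) \<le> V n" using SUP_enat_attained by blast
  from main[OF this] show ?thesis
    unfolding Let_def V_def[symmetric] u_def[symmetric] bound M_def .
qed

end
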